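(* Let $(\hat\Omega,\mathcal B(\hat\Omega),\mu)$ be a $\sigma$-finite Hausdorff topological measure space ($\mu$ a $\sigma$-finite Borel measure of full support), $\Omega\subseteq\hat\Omega$ a Borel set, and let $\Phi:\hat\Omega\times\hat\Omega\times\mathbb R\to[0,\infty]$ satisfy the standard conditions. Let $\mathcal E(\hat u)=\frac12\int_{\hat\Omega}\int_{\hat\Omega}\Phi(x,y,\hat u(x)-\hat u(y))\,d\mu(y)d\mu(x)$ on $W^{\Phi,2}(\hat\Omega,\Omega)$ and $j(\hat u)=\hat u|_\Omega\in L^2(\Omega)$. Let $\tilde\Omega$ be a compactification of $\hat\Omega$ such that $\mathcal E$ is regular with respect to $\tilde\Omega$. Let $B:\tilde\Omega\times\mathbb R\to[0,\infty]$ be such that $B(x,0)=0$, $B(x,\cdot)$ is lower semicontinuous and convex for every $x$, $B(\cdot,s)$ is measurable for every $s$; let $\nu$ be a Borel measure on $\tilde\Omega$ absolutely continuous with respect to $\operatorname{Cap}_{\mathcal E}$, and suppose that $B$ and its conjugate $B^*$ satisfy the $\Delta_2$-condition with respect to $\nu$. Let $\mathcal E_{B,\nu}(\hat u)=\mathcal E(\hat u)+\int_{\tilde\Omega}B(x,\hat u(x))\,d\nu(x)$ for $\hat u\in W^{\Phi,2}(\hat\Omega,\Omega)$ (quasi-continuous representatives). Assume that $\Phi$ and $B$ are continuously partially differentiable in the last variable, with derivatives $\varphi$ and $\beta$ (conditions (D) and (D$_B$) of the context). Let $\mathcal D\subseteq W^{\Phi,2}(\hat\Omega,\Omega)\cap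 L^B(\tilde\Omega,\nu)$ be a linear subspace which separates the points of its associate space $\mathcal D_a$. Then for every $u,f\in L^2(\Omega)$ one has $(u,f)\in\partial_j\mathcal E_{B,\nu}$ if and only if there exists $\hat u\in W^{\Phi,2}(\hat\Omega,\Omega)\cap L^B(\tilde\Omega,\nu)$ such that $\hat u|_\Omega=u$, $\hat u$ is a weak solution of $$\begin{cases}P.V.\int_{\hat\Omega}\varphi(x,y,\hat u(x)-\hat u(y))\,d\mu(y)+\beta(x,\hat u(x))\frac{d\nu}{d\mu}(x)=f(x)&\text{for }x\in\Omega,\\ P.V.\int_{\hat\Omega}\varphi(x,y,\hat u(x)-\hat u(y))\,d\mu(y)+\beta(x,\hat u(x))\frac{d\nu}{d\mu}(x)=0&\text{for }x\in\tilde\Omega\setminus\Omega,\end{cases}$$ and, moreover, for every $\hat v\in W^{\Phi,2}(\hat\Omega,\Omega)\cap L^B(\tilde\Omega,\nu)$, $$\tfrac12\int_{\hat\Omega}\int_{\hat\Omega}\varphi(x,y,\hat u(x)-\hat u(y))(\hat v(x)-\hat v(y))\,d\mu(y)d\mu(x)+\int_{\tilde\Omega}\beta(x,\hat u(x))\hat v(x)\,d\nu(x)=\int_{\hat\Omega}\Big(P.V.\!\int_{\hat\Omega}\varphi(x,y,\hat u(x)-\hat u(y))\,d\mu(y)\Big)\hat v(x)\,d\mu(x).$$ Every such $\hat u$ is an elliptic extension of $u$ and satisfies $\hat u=\operatorname{arg\,min}_{j(\hat w)=u}(\mathcal E_{B,\nu}(\hat w)-\int_\Omega f\hat w\,d\mu)=\operatorname{arg\,min}_{j(\hat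 w)=u}\mathcal E_{B,\nu}(\hat w)$. The elliptic extension is unique when $\Phi(x,y,\cdot)$ is strictly convex for every $(x,y)\in\mathbf S_\Phi$.
   Context: $L^0(X)$ denotes real measurable functions on $X$ modulo a.e. equality. Condition (C) on $\Phi$: $\Phi(\cdot,\cdot,s)$ is measurable for every $s$; and for all $x,y$: $\Phi(x,y,0)=0$, $\Phi(x,y,\cdot)$ is lower semicontinuous, convex and even, and $\Phi(x,y,\cdot)=\Phi(y,x,\cdot)$. Fenchel conjugate: $\Phi^*(x,y,t)=\sup_{s}(st-\Phi(x,y,s))$. $\Delta_2$-condition: there are $K>0$ and a $\mu\otimes\mu$-integrable $h\ge0$ with $\Phi(x,y,2s)\le K\Phi(x,y,s)+h(x,y)$ for all $x,y,s$. Analogously $B^*(x,t)=\sup_s(st-B(x,s))$, and $B$ satisfies the $\Delta_2$-condition with respect to $\nu$ if $B(x,2s)\le KB(x,s)+h(x)$ for all $x,s$ with some $K>0$ and $\nu$-integrable $h\ge0$. $\mathbf S_\Phi=(\hat\Omega\times\hat\Omega)\setminus\{(x,y):\Phi(x,y,s)=0\ \forall s\}$. Thickness condition on $\mathbf S_\Phi$: there exist a sequence $(A^{(0)}_n)_{n\in\mathbb N}$ of measurable subsets of $\Omega$ and a set $\hat N\subseteq\hat\Omega$ of measure zero such that, when we define and choose recursively for $m\ge0$: $I^{(m)}:=\{n\in\mathbb N:\mu(A^{(m)}_n)>0\}$; $(B^{(m+1)}_n)_{n\in\mathbb N}$ any sequence of measurable sets such that $A^{(m)}_n\times B^{(m+1)}_n\subseteq\mathbf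 S_\Phi$ for every $n\in\mathbb N$; $(A^{(m+1)}_n)_{n\in\mathbb N}$ any sequence of measurable sets such that $\bigcup_nA^{(m+1)}_n=\bigcup_nB^{(m+1)}_n$; then $\hat\Omega\setminus\hat N=\bigcup_{m\in\mathbb N}\bigcup_{n\in I^{(m)}}A^{(m)}_n$. Standard conditions: $\Phi$ satisfies (C), $\Phi$ and $\Phi^*$ satisfy the $\Delta_2$-condition, $\mathbf S_\Phi$ satisfies the thickness condition. Condition (D): there is $\varphi:\hat\Omega\times\hat\Omega\times\mathbb R\to\mathbb R$ such that $\varphi(\cdot,\cdot,s)$ is measurable and symmetric for every $s$, $\varphi(x,y,0)=0$, $\varphi(x,y,\cdot)$ is continuous, increasing and odd, and $\Phi(x,y,s)=\int_0^s\varphi(x,y,\tau)\,d\tau$. Condition (D$_B$): there is $\beta:\tilde\Omega\times\mathbb R\to\mathbb R$ such that $\beta(\cdot,s)$ is measurable for every $s$, $\beta(x,0)=0$, $\beta(x,\cdot)$ is continuous, increasing and odd, and $B(x,s)=\int_0^s\beta(x,\tau)\,d\tau$. $W^{\Phi,0}(\hat\Omega)=\{\hat u\in L^0(\hat\Omega):\exists\lambda>0,\ \int\int\Phi(x,y,(\hat u(x)-\hat u(y))/\lambda)\,d\mu d\mu<\infty\}$ with seminorm $\|\hat u\|_{W^{\Phi,0}}=\inf\{\lambda>0:\int\int\Phi(x,y,(\hat u(x)-\hat u(y))/\lambda)\,d\mu d\mu\le1\}$; $W^{\Phi,2}(\hat\Omega,\Omega)=\{\hat u\in W^{\Phi,0}(\hat\Omega):\hat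 u|_\Omega\in L^2(\Omega)\}$ with norm $\|\hat u|_\Omega\|_{L^2(\Omega)}+\|\hat u\|_{W^{\Phi,0}}$. $L^B(\tilde\Omega,\nu)$ is the Musielak-Orlicz space of measurable $w$ with $\int_{\tilde\Omega}B(x,w/\lambda)\,d\nu<\infty$ for some $\lambda>0$. Compactification: $\tilde\Omega$ is compact with a continuous embedding $\hat\Omega\to\tilde\Omega$ of dense range; $C(\tilde\Omega)$ is identified with restrictions to $\hat\Omega$; $\mu(\tilde\Omega\setminus\hat\Omega):=0$. $\mathcal E$ is regular with respect to $\tilde\Omega$ if $W^{\Phi,2}(\hat\Omega,\Omega)\cap C(\tilde\Omega)$ is dense in $W^{\Phi,2}(\hat\Omega,\Omega)$ and its linear span with the constant $1$ is sup-norm dense in $C(\tilde\Omega)$. For Borel $A\subseteq\tilde\Omega$: $\operatorname{Cap}_{\mathcal E}(A)=\inf\{\|\hat w\|^2_{W^{\Phi,2}}+\mu((A\cap\hat\Omega)\setminus\Omega):\hat w\in W^{\Phi,2}(\hat\Omega,\Omega),\ \hat w\ge1\ \mu\text{-a.e. on an open }U\supseteq A\}$. Polar: capacity zero. $\hat w:\tilde\Omega\to\mathbb R$ is quasi-continuous if for every $\varepsilon>0$ there is an open $U$ with $\operatorname{Cap}_{\mathcal E}(U)\le\varepsilon$ and $\hat w$ continuous on $\tilde\Omega\setminus U$; in the regular case every $\hat u\in W^{\Phi,2}(\hat\Omega,\Omega)$ has a quasi-continuous representative on $\tilde\Omega$, unique up to polar sets (known). $\nu$ is absolutely continuous with respect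 to $\operatorname{Cap}_{\mathcal E}$ if $\nu(A)=0$ for polar Borel $A$. $\partial_j\mathcal E_{B,\nu}$: set of $(u,f)\in L^2(\Omega)^2$ for which there is $\hat u\in W^{\Phi,2}(\hat\Omega,\Omega)$ with $\mathcal E_{B,\nu}(\hat u)<\infty$, $j(\hat u)=u$ and $\mathcal E_{B,\nu}(\hat u+\hat v)-\mathcal E_{B,\nu}(\hat u)\ge\int_\Omega f\,j(\hat v)\,d\mu$ for all $\hat v\in W^{\Phi,2}(\hat\Omega,\Omega)$; such $\hat u$ is an elliptic extension of $u$. $\mathcal D_a=\{\hat g\in L^0(\hat\Omega):\hat g\hat v\in L^1(\hat\Omega)\ \forall\hat v\in\mathcal D\}$; $\mathcal D$ separates the points of $\mathcal D_a$ if $\hat g\in\mathcal D_a$ and $\int\hat g\hat v\,d\mu=0$ for all $\hat v\in\mathcal D$ imply $\hat g=0$. The Cauchy principal value $P.V.\int_{\hat\Omega}\varphi(x,y,\hat u(x)-\hat u(y))\,d\mu(y)$ exists in a weak sense and equals $\hat g\in\mathcal D_a$ if $\frac12\int\int\varphi(x,y,\hat u(x)-\hat u(y))(\hat v(x)-\hat v(y))\,d\mu(y)d\mu(x)=\int_{\hat\Omega}\hat g\hat v\,d\mu$ for every $\hat v\in\mathcal D$. For $\hat f\in\mathcal D_a$, $\hat u$ is a weak solution of $P.V.\int_{\hat\Omega}\varphi(x,y,\hat u(x)-\hat u(y))\,d\mu(y)+\beta(x,\hat u(x))\frac{d\nu}{d\mu}(x)=\hat f(x)$ (the symbol $\frac{d\nu}{d\mu}$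 is only formal) if for every $\hat v\in\mathcal D$: $\frac12\int\int\varphi(x,y,\hat u(x)-\hat u(y))(\hat v(x)-\hat v(y))\,d\mu(y) d\mu(x)+\int_{\tilde\Omega}\beta(x,\hat u(x))\hat v(x)\,d\nu(x)=\int_{\hat\Omega}\hat f\hat v\,d\mu$. The displayed system is this equation with $\hat f=f$ on $\Omega$, $\hat f=0$ on $\hat\Omega\setminus\Omega$.
   Formalization: In the last identity the P.V. on the right is read as the weak value of the whole left side, including β dν/dμ (false otherwise); in the thickness condition the sequences are chosen existentially and only the B_n with n in I^(m) are passed on (otherwise every set is thick and uniqueness fails). *)

theory Defs
  imports "HOL-Analysis.Analysis"
begin

text \<open>
  The space \<open>\<Omega>^\<close> is a whole type \<open>'a\<close>, carrying the Borel measure \<open>\<mu>\<close>; its compactification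
  \<open>\<Omega>~\<close> is a whole type \<open>'b\<close>, and \<open>\<iota> :: 'a \<Rightarrow> 'b\<close> is the embedding. Elements of \<open>L^0\<close>, and of the
  spaces derived from it, are represented by measurable functions; equality in \<open>L^0\<close> is equality
  almost everywhere, and every notion below depends on the a.e. class only.
\<close>

section \<open>Convex integrands\<close>

definition lsc_fun :: "(real \<Rightarrow> ennreal) \<Rightarrow> bool" where
  "lsc_fun F \<longleftrightarrow> (\<forall>c. open {s. c < F s})"

definition convex_fun :: "(real \<Rightarrow> ennreal) \<Rightarrow> bool" where
  "convex_fun F \<longleftrightarrow> (\<forall>s t a. 0 \<le> a \<and> a \<le> 1 \<longrightarrow>
     F (a * s + (1 - a) * t) \<le> ennreal a * F s + ennreal (1 - a) * F t)"

definition strictly_convex_fun :: "(real \<Rightarrow> ennreal) \<Rightarrow> bool" where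
  "strictly_convex_fun F \<longleftrightarrow> (\<forall>s t a. s \<noteq> t \<and> F s < \<infinity> \<and> F t < \<infinity> \<and> 0 < a \<and> a < 1 \<longrightarrow>
     F (a * s + (1 - a) * t) < ennreal a * F s + ennreal (1 - a) * F t)"

text \<open>If \<open>F 0 = 0\<close>, the supremum is nonnegative, so the conversion to \<^typ>\<open>ennreal\<close> loses nothing.\<close>

definition conjugate :: "(real \<Rightarrow> ennreal) \<Rightarrow> real \<Rightarrow> ennreal" where
  "conjugate F t = e2ennreal (SUP s. ereal (s * t) - enn2ereal (F s))"

definition delta2 :: "'c measure \<Rightarrow> ('c \<Rightarrow> real \<Rightarrow> ennreal) \<Rightarrow> bool" where
  "delta2 M F \<longleftrightarrow> (\<exists>K>0. \<exists>h. integrable M h \<and> (\<forall>x. 0 \<le> h x) \<and>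
     (\<forall>x s. F x (2 * s) \<le> ennreal K * F x s + ennreal (h x)))"

definition condition_C :: "'a measure \<Rightarrow> ('a \<Rightarrow> 'a \<Rightarrow> real \<Rightarrow> ennreal) \<Rightarrow> bool" where
  "condition_C \<mu> \<Phi> \<longleftrightarrow>
     (\<forall>s. (\<lambda>(x, y). \<Phi> x y s) \<in> borel_measurable (\<mu> \<Otimes>\<^sub>M \<mu>)) \<and>
     (\<forall>x y. \<Phi> x y 0 = 0 \<and> lsc_fun (\<Phi> x y) \<and> convex_fun (\<Phi> x y) \<and>
            (\<forall>s. \<Phi> x y (- s) = \<Phi> x y s) \<and> \<Phi> x y = \<Phi> y x)"

definition S_set :: "('a \<Rightarrow> 'a \<Rightarrow> real \<Rightarrow> ennreal) \<Rightarrow> ('a \<times> 'a) set" where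
  "S_set \<Phi> = UNIV - {(x, y). \<forall>s. \<Phi> x y s = 0}"

text \<open>
  Only the \<open>B (m+1) n\<close> with \<open>A m n\<close> of positive measure are passed on to the next generation. A set
  \<open>A m n\<close> of measure zero, for instance the empty one, puts no effective constraint on \<open>B (m+1) n\<close>;
  letting it contribute would make the condition hold for every \<open>S\<close>.
\<close>

definition thick :: "'a measure \<Rightarrow> 'a set \<Rightarrow> ('a \<times> 'a) set \<Rightarrow> bool" where
  "thick \<mu> \<Omega> S \<longleftrightarrow> (\<exists>(A :: nat \<Rightarrow> nat \<Rightarrow> 'a set) (B :: nat \<Rightarrow> nat \<Rightarrow> 'a set) (I :: nat \<Rightarrow> nat set).
     \<exists>N \<in> null_sets \<mu>.
       (\<forall>m n. A m n \<in> sets \<mu> \<and> B m n \<in> sets \<mu>) \<and>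
       (\<forall>n. A 0 n \<subseteq> \<Omega>) \<and>
       (\<forall>m. I m = {n. 0 < emeasure \<mu> (A m n)}) \<and>
       (\<forall>m n. A m n \<times> B (Suc m) n \<subseteq> S) \<and>
       (\<forall>m. (\<Union>n. A (Suc m) n) = (\<Union>n\<in>I m. B (Suc m) n)) \<and>
       UNIV - N = (\<Union>m. \<Union>n\<in>I m. A m n))"

definition standard_conditions :: "'a measure \<Rightarrow> 'a set \<Rightarrow> ('a \<Rightarrow> 'a \<Rightarrow> real \<Rightarrow> ennreal) \<Rightarrow> bool" where
  "standard_conditions \<mu> \<Omega> \<Phi> \<longleftrightarrow>
     condition_C \<mu> \<Phi> \<and>
     delta2 (\<mu> \<Otimes>\<^sub>M \<mu>) (\<lambda>(x, y). \<Phi> x y) \<and>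
     delta2 (\<mu> \<Otimes>\<^sub>M \<mu>) (\<lambda>(x, y). conjugate (\<Phi> x y)) \<and>
     thick \<mu> \<Omega> (S_set \<Phi>)"

text \<open>``Increasing'' is meant in the weak sense. The integrals are oriented, hence nonnegative for
  \<open>s < 0\<close> too, because the integrands are odd and increasing.\<close>

definition condition_D ::
  "'a measure \<Rightarrow> ('a \<Rightarrow> 'a \<Rightarrow> real \<Rightarrow> ennreal) \<Rightarrow> ('a \<Rightarrow> 'a \<Rightarrow> real \<Rightarrow> real) \<Rightarrow> bool" where
  "condition_D \<mu> \<Phi> \<phi> \<longleftrightarrow>
     (\<forall>s. (\<lambda>(x, y). \<phi> x y s) \<in> borel_measurable (\<mu> \<Otimes>\<^sub>M \<mu>)) \<and>
     (\<forall>x y s. \<phi> x y s = \<phi> y x s) \<and>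
     (\<forall>x y. \<phi> x y 0 = 0 \<and> continuous_on UNIV (\<phi> x y) \<and> mono (\<phi> x y) \<and>
            (\<forall>s. \<phi> x y (- s) = - \<phi> x y s) \<and>
            (\<forall>s. \<Phi> x y s = ennreal (LBINT t=ereal 0..ereal s. \<phi> x y t)))"

definition condition_DB ::
  "'b measure \<Rightarrow> ('b \<Rightarrow> real \<Rightarrow> ennreal) \<Rightarrow> ('b \<Rightarrow> real \<Rightarrow> real) \<Rightarrow> bool" where
  "condition_DB \<nu> B \<beta> \<longleftrightarrow>
     (\<forall>s. (\<lambda>x. \<beta> x s) \<in> borel_measurable \<nu>) \<and>
     (\<forall>x. \<beta> x 0 = 0 \<and> continuous_on UNIV (\<beta> x) \<and> mono (\<beta> x) \<and>
          (\<forall>s. \<beta> x (- s) = - \<beta> x s) \<and>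
          (\<forall>s. B x s = ennreal (LBINT t=ereal 0..ereal s. \<beta> x t)))"

section \<open>Function spaces and the energy\<close>

definition L2 :: "'a measure \<Rightarrow> 'a set \<Rightarrow> ('a \<Rightarrow> real) set" where
  "L2 \<mu> \<Omega> = {u. set_borel_measurable \<mu> \<Omega> u \<and> set_integrable \<mu> \<Omega> (\<lambda>x. (u x)\<^sup>2)}"

definition modular ::
  "'a measure \<Rightarrow> ('a \<Rightarrow> 'a \<Rightarrow> real \<Rightarrow> ennreal) \<Rightarrow> ('a \<Rightarrow> real) \<Rightarrow> real \<Rightarrow> ennreal" where
  "modular \<mu> \<Phi> u l = (\<integral>\<^sup>+x. (\<integral>\<^sup>+y. \<Phi> x y ((u x - u y) / l) \<partial>\<mu>) \<partial>\<mu>)"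

definition W0 :: "'a measure \<Rightarrow> ('a \<Rightarrow> 'a \<Rightarrow> real \<Rightarrow> ennreal) \<Rightarrow> ('a \<Rightarrow> real) set" where
  "W0 \<mu> \<Phi> = {u \<in> borel_measurable \<mu>. \<exists>l>0. modular \<mu> \<Phi> u l < \<infinity>}"

definition W0_norm :: "'a measure \<Rightarrow> ('a \<Rightarrow> 'a \<Rightarrow> real \<Rightarrow> ennreal) \<Rightarrow> ('a \<Rightarrow> real) \<Rightarrow> real" where
  "W0_norm \<mu> \<Phi> u = Inf {l. 0 < l \<and> modular \<mu> \<Phi> u l \<le> 1}"

definition W2 :: "'a measure \<Rightarrow> 'a set \<Rightarrow> ('a \<Rightarrow> 'a \<Rightarrow> real \<Rightarrow> ennreal) \<Rightarrow> ('a \<Rightarrow> real) set" where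
  "W2 \<mu> \<Omega> \<Phi> = W0 \<mu> \<Phi> \<inter> L2 \<mu> \<Omega>"

definition W2_norm ::
  "'a measure \<Rightarrow> 'a set \<Rightarrow> ('a \<Rightarrow> 'a \<Rightarrow> real \<Rightarrow> ennreal) \<Rightarrow> ('a \<Rightarrow> real) \<Rightarrow> real" where
  "W2_norm \<mu> \<Omega> \<Phi> u = sqrt (LINT x:\<Omega>|\<mu>. (u x)\<^sup>2) + W0_norm \<mu> \<Phi> u"

definition energy :: "'a measure \<Rightarrow> ('a \<Rightarrow> 'a \<Rightarrow> real \<Rightarrow> ennreal) \<Rightarrow> ('a \<Rightarrow> real) \<Rightarrow> ennreal" where
  "energy \<mu> \<Phi> u = (\<integral>\<^sup>+x. (\<integral>\<^sup>+y. \<Phi> x y (u x - u y) \<partial>\<mu>) \<partial>\<mu>) / 2"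

text \<open>The relation \<open>j(w) = u\<close> in \<open>L^2(\<Omega>)\<close>.\<close>

definition restricts_to :: "'a measure \<Rightarrow> 'a set \<Rightarrow> ('a \<Rightarrow> real) \<Rightarrow> ('a \<Rightarrow> real) \<Rightarrow> bool" where
  "restricts_to \<mu> \<Omega> w u \<longleftrightarrow> (AE x in \<mu>. x \<in> \<Omega> \<longrightarrow> w x = u x)"

section \<open>Compactification, capacity, quasi-continuity\<close>

definition compactification :: "('a::topological_space \<Rightarrow> 'b::topological_space) \<Rightarrow> bool" where
  "compactification \<iota> \<longleftrightarrow> compact (UNIV :: 'b set) \<and> continuous_on UNIV \<iota> \<and> inj \<iota> \<and>
     closure (range \<iota>) = UNIV"

text \<open>The continuous functions on \<open>\<Omega>~\<close> whose restriction to \<open>\<Omega>^\<close> lies in \<open>W^{\<Phi>,2}\<close>. They form a linear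
  space, so its span with the constant \<open>1\<close> consists of the functions \<open>h + c\<close>.\<close>

definition W2_cont :: "'a measure \<Rightarrow> 'a set \<Rightarrow> ('a \<Rightarrow> 'a \<Rightarrow> real \<Rightarrow> ennreal) \<Rightarrow>
    ('a \<Rightarrow> 'b::topological_space) \<Rightarrow> ('b \<Rightarrow> real) set" where
  "W2_cont \<mu> \<Omega> \<Phi> \<iota> = {h. continuous_on UNIV h \<and> h \<circ> \<iota> \<in> W2 \<mu> \<Omega> \<Phi>}"

definition regular_energy :: "'a measure \<Rightarrow> 'a set \<Rightarrow> ('a \<Rightarrow> 'a \<Rightarrow> real \<Rightarrow> ennreal) \<Rightarrow>
    ('a \<Rightarrow> 'b::topological_space) \<Rightarrow> bool" where
  "regular_energy \<mu> \<Omega> \<Phi> \<iota> \<longleftrightarrow>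
     (\<forall>u \<in> W2 \<mu> \<Omega> \<Phi>. \<forall>e>0. \<exists>h \<in> W2_cont \<mu> \<Omega> \<Phi> \<iota>. W2_norm \<mu> \<Omega> \<Phi> (\<lambda>x. u x - h (\<iota> x)) < e) \<and>
     (\<forall>g :: 'b \<Rightarrow> real. continuous_on UNIV g \<longrightarrow>
        (\<forall>e>0. \<exists>h \<in> W2_cont \<mu> \<Omega> \<Phi> \<iota>. \<exists>c. \<forall>x. \<bar>g x - (h x + c)\<bar> < e))"

text \<open>As \<open>\<mu>(\<Omega>~ - \<Omega>^) = 0\<close>, the measure of a subset of \<open>\<Omega>~\<close> is that of its preimage under \<open>\<iota>\<close>.\<close>

definition Cap :: "'a measure \<Rightarrow> 'a set \<Rightarrow> ('a \<Rightarrow> 'a \<Rightarrow> real \<Rightarrow> ennreal) \<Rightarrow>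
    ('a \<Rightarrow> 'b::topological_space) \<Rightarrow> 'b set \<Rightarrow> ennreal" where
  "Cap \<mu> \<Omega> \<Phi> \<iota> A =
     (INF w \<in> {w \<in> W2 \<mu> \<Omega> \<Phi>. \<exists>U. open U \<and> A \<subseteq> U \<and> (AE x in \<mu>. \<iota> x \<in> U \<longrightarrow> 1 \<le> w x)}.
        ennreal ((W2_norm \<mu> \<Omega> \<Phi> w)\<^sup>2) + emeasure \<mu> (\<iota> -` A - \<Omega>))"

definition quasi_continuous :: "'a measure \<Rightarrow> 'a set \<Rightarrow> ('a \<Rightarrow> 'a \<Rightarrow> real \<Rightarrow> ennreal) \<Rightarrow>
    ('a \<Rightarrow> 'b::topological_space) \<Rightarrow> ('b \<Rightarrow> real) \<Rightarrow> bool" where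
  "quasi_continuous \<mu> \<Omega> \<Phi> \<iota> w \<longleftrightarrow>
     (\<forall>e>0. \<exists>U. open U \<and> Cap \<mu> \<Omega> \<Phi> \<iota> U \<le> ennreal e \<and> continuous_on (- U) w)"

definition qc_rep :: "'a measure \<Rightarrow> 'a set \<Rightarrow> ('a \<Rightarrow> 'a \<Rightarrow> real \<Rightarrow> ennreal) \<Rightarrow>
    ('a \<Rightarrow> 'b::topological_space) \<Rightarrow> ('a \<Rightarrow> real) \<Rightarrow> ('b \<Rightarrow> real) \<Rightarrow> bool" where
  "qc_rep \<mu> \<Omega> \<Phi> \<iota> u w \<longleftrightarrow> quasi_continuous \<mu> \<Omega> \<Phi> \<iota> w \<and> (AE x in \<mu>. w (\<iota> x) = u x)"

text \<open>Quasi-continuous representatives are unique up to polar sets, so integrals with respect to a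
  measure that does not charge polar sets do not depend on the choice. They are Borel measurable
  only up to a polar set; this is why such integrals are taken over the completion below.\<close>

definition qc :: "'a measure \<Rightarrow> 'a set \<Rightarrow> ('a \<Rightarrow> 'a \<Rightarrow> real \<Rightarrow> ennreal) \<Rightarrow>
    ('a \<Rightarrow> 'b::topological_space) \<Rightarrow> ('a \<Rightarrow> real) \<Rightarrow> 'b \<Rightarrow> real" where
  "qc \<mu> \<Omega> \<Phi> \<iota> u = (SOME w. qc_rep \<mu> \<Omega> \<Phi> \<iota> u w)"

definition cap_abs_continuous :: "'a measure \<Rightarrow> 'a set \<Rightarrow> ('a \<Rightarrow> 'a \<Rightarrow> real \<Rightarrow> ennreal) \<Rightarrow>
    ('a \<Rightarrow> 'b::topological_space) \<Rightarrow> 'b measure \<Rightarrow> bool" where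
  "cap_abs_continuous \<mu> \<Omega> \<Phi> \<iota> \<nu> \<longleftrightarrow>
     (\<forall>A \<in> sets borel. Cap \<mu> \<Omega> \<Phi> \<iota> A = 0 \<longrightarrow> emeasure \<nu> A = 0)"

section \<open>The perturbed energy and its j-subgradient\<close>

definition LB :: "'b measure \<Rightarrow> ('b \<Rightarrow> real \<Rightarrow> ennreal) \<Rightarrow> ('b \<Rightarrow> real) set" where
  "LB \<nu> B = {w \<in> borel_measurable (completion \<nu>).
     \<exists>l>0. (\<integral>\<^sup>+x. B x (w x / l) \<partial>completion \<nu>) < \<infinity>}"

definition W2_LB :: "'a measure \<Rightarrow> 'a set \<Rightarrow> ('a \<Rightarrow> 'a \<Rightarrow> real \<Rightarrow> ennreal) \<Rightarrow>
    ('a \<Rightarrow> 'b::topological_space) \<Rightarrow> 'b measure \<Rightarrow> ('b \<Rightarrow> real \<Rightarrow> ennreal) \<Rightarrow> ('a \<Rightarrow> real) set" where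
  "W2_LB \<mu> \<Omega> \<Phi> \<iota> \<nu> B = {u \<in> W2 \<mu> \<Omega> \<Phi>. \<exists>w. qc_rep \<mu> \<Omega> \<Phi> \<iota> u w \<and> w \<in> LB \<nu> B}"

text \<open>The value \<open>\<infinity>\<close> is a convention for functions without quasi-continuous representative; it is
  never used where all of \<open>W^{\<Phi>,2}\<close> is known to have such representatives.\<close>

definition energy_B :: "'a measure \<Rightarrow> 'a set \<Rightarrow> ('a \<Rightarrow> 'a \<Rightarrow> real \<Rightarrow> ennreal) \<Rightarrow>
    ('a \<Rightarrow> 'b::topological_space) \<Rightarrow> 'b measure \<Rightarrow> ('b \<Rightarrow> real \<Rightarrow> ennreal) \<Rightarrow>
    ('a \<Rightarrow> real) \<Rightarrow> ennreal" where
  "energy_B \<mu> \<Omega> \<Phi> \<iota> \<nu> B u =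
     (if \<exists>w. qc_rep \<mu> \<Omega> \<Phi> \<iota> u w
      then energy \<mu> \<Phi> u + (\<integral>\<^sup>+x. B x (qc \<mu> \<Omega> \<Phi> \<iota> u x) \<partial>completion \<nu>)
      else \<infinity>)"

text \<open>\<open>u'\<close> is an elliptic extension of \<open>u\<close>, as a witness of the pair \<open>(u, f)\<close> being in the j-subgradient
  of \<open>F\<close>.\<close>

definition elliptic_extension :: "'a measure \<Rightarrow> 'a set \<Rightarrow> ('a \<Rightarrow> 'a \<Rightarrow> real \<Rightarrow> ennreal) \<Rightarrow>
    (('a \<Rightarrow> real) \<Rightarrow> ennreal) \<Rightarrow> ('a \<Rightarrow> real) \<Rightarrow> ('a \<Rightarrow> real) \<Rightarrow> ('a \<Rightarrow> real) \<Rightarrow> bool" where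
  "elliptic_extension \<mu> \<Omega> \<Phi> F u f u' \<longleftrightarrow>
     u' \<in> W2 \<mu> \<Omega> \<Phi> \<and> F u' < \<infinity> \<and> restricts_to \<mu> \<Omega> u' u \<and>
     (\<forall>v \<in> W2 \<mu> \<Omega> \<Phi>. enn2ereal (F (\<lambda>x. u' x + v x)) - enn2ereal (F u')
                       \<ge> ereal (LINT x:\<Omega>|\<mu>. f x * v x))"

definition j_subgradient :: "'a measure \<Rightarrow> 'a set \<Rightarrow> ('a \<Rightarrow> 'a \<Rightarrow> real \<Rightarrow> ennreal) \<Rightarrow>
    (('a \<Rightarrow> real) \<Rightarrow> ennreal) \<Rightarrow> (('a \<Rightarrow> real) \<times> ('a \<Rightarrow> real)) set" where
  "j_subgradient \<mu> \<Omega> \<Phi> F =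
     {(u, f). u \<in> L2 \<mu> \<Omega> \<and> f \<in> L2 \<mu> \<Omega> \<and> (\<exists>u'. elliptic_extension \<mu> \<Omega> \<Phi> F u f u')}"

section \<open>Weak solutions\<close>

definition linear_subspace :: "('a \<Rightarrow> real) set \<Rightarrow> bool" where
  "linear_subspace D \<longleftrightarrow> (\<lambda>x. 0) \<in> D \<and> (\<forall>v\<in>D. \<forall>w\<in>D. (\<lambda>x. v x + w x) \<in> D) \<and>
     (\<forall>c. \<forall>v\<in>D. (\<lambda>x. c * v x) \<in> D)"

definition associate :: "'a measure \<Rightarrow> ('a \<Rightarrow> real) set \<Rightarrow> ('a \<Rightarrow> real) set" where
  "associate \<mu> D = {g \<in> borel_measurable \<mu>. \<forall>v\<in>D. integrable \<mu> (\<lambda>x. g x * v x)}"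

definition separates_associate :: "'a measure \<Rightarrow> ('a \<Rightarrow> real) set \<Rightarrow> bool" where
  "separates_associate \<mu> D \<longleftrightarrow>
     (\<forall>g \<in> associate \<mu> D. (\<forall>v\<in>D. (LINT x|\<mu>. g x * v x) = 0) \<longrightarrow> (AE x in \<mu>. g x = 0))"

text \<open>For \<open>u\<close> and \<open>v\<close> in \<open>W2_LB\<close> both integrals converge absolutely, by Young's inequality and the
  \<open>\<Delta>\<^sub>2\<close>-conditions.\<close>

definition weak_form :: "'a measure \<Rightarrow> 'a set \<Rightarrow> ('a \<Rightarrow> 'a \<Rightarrow> real \<Rightarrow> ennreal) \<Rightarrow>
    ('a \<Rightarrow> 'a \<Rightarrow> real \<Rightarrow> real) \<Rightarrow> ('a \<Rightarrow> 'b::topological_space) \<Rightarrow> 'b measure \<Rightarrow>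
    ('b \<Rightarrow> real \<Rightarrow> real) \<Rightarrow> ('a \<Rightarrow> real) \<Rightarrow> ('a \<Rightarrow> real) \<Rightarrow> real" where
  "weak_form \<mu> \<Omega> \<Phi> \<phi> \<iota> \<nu> \<beta> u v =
     1/2 * (LINT x|\<mu>. (LINT y|\<mu>. \<phi> x y (u x - u y) * (v x - v y))) +
     (LINT x|completion \<nu>. \<beta> x (qc \<mu> \<Omega> \<Phi> \<iota> u x) * qc \<mu> \<Omega> \<Phi> \<iota> v x)"

text \<open>\<open>u\<close> is a weak solution of \<open>P.V.\<integral> \<phi>(x, y, u(x) - u(y)) d\<mu>(y) + \<beta>(x, u(x)) d\<nu>/d\<mu>(x) = g(x)\<close>; in
  other words, the left-hand side exists in the weak sense and equals \<open>g\<close>.\<close>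

definition weak_solution :: "'a measure \<Rightarrow> 'a set \<Rightarrow> ('a \<Rightarrow> 'a \<Rightarrow> real \<Rightarrow> ennreal) \<Rightarrow>
    ('a \<Rightarrow> 'a \<Rightarrow> real \<Rightarrow> real) \<Rightarrow> ('a \<Rightarrow> 'b::topological_space) \<Rightarrow> 'b measure \<Rightarrow>
    ('b \<Rightarrow> real \<Rightarrow> real) \<Rightarrow> ('a \<Rightarrow> real) set \<Rightarrow> ('a \<Rightarrow> real) \<Rightarrow> ('a \<Rightarrow> real) \<Rightarrow> bool" where
  "weak_solution \<mu> \<Omega> \<Phi> \<phi> \<iota> \<nu> \<beta> D u g \<longleftrightarrow>
     g \<in> associate \<mu> D \<and> (\<forall>v\<in>D. weak_form \<mu> \<Omega> \<Phi> \<phi> \<iota> \<nu> \<beta> u v = (LINT x|\<mu>. g x * v x))"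

text \<open>
  \<open>u'\<close> extends \<open>u\<close>, solves the system weakly (right-hand side \<open>f\<close> on \<open>\<Omega>\<close>, \<open>0\<close> elsewhere), and the
  weak identity extends from \<open>D\<close> to all of \<open>W2_LB\<close>. In the last conjunct \<open>g\<close> is the weak value of the
  whole left-hand side of the system. It has to include the formal term \<open>\<beta> d\<nu>/d\<mu>\<close>, since the
  \<open>\<beta>\<close>-integral also occurs in the identity itself; where \<open>D\<close> does not see \<open>\<nu>\<close>, it is just the
  principal value.
\<close>

definition extended_weak_solution :: "'a measure \<Rightarrow> 'a set \<Rightarrow> ('a \<Rightarrow> 'a \<Rightarrow> real \<Rightarrow> ennreal) \<Rightarrow>
    ('a \<Rightarrow> 'a \<Rightarrow> real \<Rightarrow> real) \<Rightarrow> ('a \<Rightarrow> 'b::topological_space) \<Rightarrow> 'b measure \<Rightarrow>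
    ('b \<Rightarrow> real \<Rightarrow> ennreal) \<Rightarrow> ('b \<Rightarrow> real \<Rightarrow> real) \<Rightarrow> ('a \<Rightarrow> real) set \<Rightarrow>
    ('a \<Rightarrow> real) \<Rightarrow> ('a \<Rightarrow> real) \<Rightarrow> ('a \<Rightarrow> real) \<Rightarrow> bool" where
  "extended_weak_solution \<mu> \<Omega> \<Phi> \<phi> \<iota> \<nu> B \<beta> D u f u' \<longleftrightarrow>
     u' \<in> W2_LB \<mu> \<Omega> \<Phi> \<iota> \<nu> B \<and>
     restricts_to \<mu> \<Omega> u' u \<and>
     weak_solution \<mu> \<Omega> \<Phi> \<phi> \<iota> \<nu> \<beta> D u' (\<lambda>x. if x \<in> \<Omega> then f x else 0) \<and>
     (\<exists>g. weak_solution \<mu> \<Omega> \<Phi> \<phi> \<iota> \<nu> \<beta> D u' g \<and>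
        (\<forall>v \<in> W2_LB \<mu> \<Omega> \<Phi> \<iota> \<nu> B.
           weak_form \<mu> \<Omega> \<Phi> \<phi> \<iota> \<nu> \<beta> u' v = (LINT x|\<mu>. g x * v x)))"

end

theory Submission
  imports Defs
begin

text \<open>
  Convexity gives \<open>\<Phi>(b) - \<Phi>(a) \<ge> \<phi>(a) (b - a)\<close>, and likewise for \<open>B\<close>, hence
  \<open>F(u + v) - F(u) \<ge> a(u; v)\<close> with \<open>F\<close> the perturbed energy and \<open>a\<close> the weak form. Conversely, if
  \<open>F(u + t v) - F(u) \<ge> t \<integral> f v\<close> for all \<open>t\<close>, the same inequality at \<open>u + t v\<close> yields
  \<open>a(u + t v; v) \<ge> \<integral> f v\<close> for \<open>t > 0\<close>, and \<open>t \<rightarrow> 0\<close> by dominated convergence. So elliptic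
  extensions are exactly the solutions of the weak identity tested with all of \<open>W2_LB\<close>; the
  separation property of \<open>D\<close> identifies the weak value of the left-hand side with \<open>f\<close> on \<open>\<Omega>\<close> and
  \<open>0\<close> elsewhere. The \<open>\<nu>\<close>-integrals respect linear combinations because quasi-continuous
  representatives are unique up to polar sets. For uniqueness, the midpoint of two extensions of
  \<open>u\<close> is again a minimizer, so strict convexity forces the difference of the extensions to satisfy
  \<open>d(x) = d(y)\<close> almost everywhere on \<open>S_\<Phi>\<close>; the thickness condition spreads \<open>d = 0\<close> from \<open>\<Omega>\<close>.
\<close>

section \<open>Convex potentials with the doubling condition\<close>

text \<open>Rounding \<open>w\<close> down to the grid of mesh \<open>1 / real (Suc n)\<close>
  leaves countably many values of the second argument, so measurability of each section suffices;
  continuity in that argument passes to the limit.\<close>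

lemma borel_measurable_caratheodory:
  fixes g :: "'c \<Rightarrow> real \<Rightarrow> real"
  assumes g: "\<And>s. (\<lambda>x. g x s) \<in> borel_measurable M" and cont: "\<And>x. continuous_on UNIV (g x)"
    and w: "w \<in> borel_measurable M"
  shows "(\<lambda>x. g x (w x)) \<in> borel_measurable M"
proof (rule borel_measurable_LIMSEQ_real)
  define k where "k n x = \<lfloor>w x * real (Suc n)\<rfloor>" for n x
  show "(\<lambda>x. g x (of_int (k n x) / real (Suc n))) \<in> borel_measurable M" for n
  proof (rule measurable_compose_countable[where f = "\<lambda>i x. g x (of_int i / real (Suc n))" and g = "k n"])
    show "k n \<in> measurable M (count_space UNIV)"
      unfolding k_def using w by measurable
  qed (rule g)
  fix x
  have "(\<lambda>n. of_int (k n x) / real (Suc n)) \<longlonglongrightarrow> w x"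
  proof (rule real_tendsto_sandwich)
    show "\<forall>\<^sub>F n in sequentially. w x - 1 / real (Suc n) \<le> of_int (k n x) / real (Suc n)"
    proof (intro always_eventually allI)
      fix n
      have "w x * real (Suc n) - 1 \<le> of_int (k n x)"
        unfolding k_def by linarith
      from divide_right_mono[OF this, of "real (Suc n)"]
      show "w x - 1 / real (Suc n) \<le> of_int (k n x) / real (Suc n)"
        by (simp add: diff_divide_distrib del: of_nat_Suc)
    qed
    show "\<forall>\<^sub>F n in sequentially. of_int (k n x) / real (Suc n) \<le> w x"
    proof (intro always_eventually allI)
      fix n show "of_int (k n x) / real (Suc n) \<le> w x"
        unfolding k_def using floor_correct[of "w x * real (Suc n)"]
        by (simp add: field_simps del: of_nat_Suc)
    qed
    show "(\<lambda>n. w x - 1 / real (Suc n)) \<longlonglongrightarrow> w x"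
      using tendsto_diff[OF tendsto_const LIMSEQ_Suc[OF lim_1_over_n], of "w x"] by simp
  qed simp
  moreover have "isCont (g x) (w x)"
    using cont[of x] by (simp add: continuous_on_eq_continuous_at)
  ultimately show "(\<lambda>n. g x (of_int (k n x) / real (Suc n))) \<longlonglongrightarrow> g x (w x)"
    by (rule isCont_tendsto_compose[rotated])
qed

text \<open>Treats both integrands at once: it is instantiated with \<open>\<Phi>\<close> on pairs
  of points under the product measure and with \<open>B\<close> under
  \<open>completion \<nu>\<close>.\<close>

locale potential =
  fixes M :: "'c measure" and F :: "'c \<Rightarrow> real \<Rightarrow> ennreal" and f :: "'c \<Rightarrow> real \<Rightarrow> real"
  assumes F_measurable: "\<And>s. (\<lambda>x. F x s) \<in> borel_measurable M"
    and f_measurable: "\<And>s. (\<lambda>x. f x s) \<in> borel_measurable M"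
    and f_cont: "\<And>x. continuous_on UNIV (f x)"
    and f_mono: "\<And>x. mono (f x)"
    and f_odd: "\<And>x s. f x (- s) = - f x s"
    and F_eq: "\<And>x s. F x s = ennreal (LBINT t=ereal 0..ereal s. f x t)"
    and F_delta2: "delta2 M F"
begin

text \<open>The integrand as a finite real number, so that derivatives and Bochner integrals apply;
  \<open>pot_nonneg\<close> shows that the truncation in \<open>ennreal\<close> loses
  nothing.\<close>

definition pot :: "'c \<Rightarrow> real \<Rightarrow> real" where
  "pot x s = (LBINT t=ereal 0..ereal s. f x t)"

lemma f_zero [simp]: "f x 0 = 0"
  using f_odd[of x 0] by simp

lemma pot_zero [simp]: "pot x 0 = 0"
  by (simp add: pot_def)

lemma pot_deriv: "(pot x has_real_derivative f x s) (at s)"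
proof -
  \<comment> \<open>An antiderivative on the whole line serves upper limits of either sign at
    once.\<close>
  obtain G where G: "\<And>t. (G has_vector_derivative f x t) (at t)"
    using einterval_antiderivative[of "-\<infinity>" \<infinity> "f x"] f_cont[of x]
    by (auto simp: continuous_on_eq_continuous_at)
  have "pot x t = G t - G 0" for t
    unfolding pot_def
    by (rule interval_integral_FTC_finite)
      (auto intro: continuous_on_subset[OF f_cont] has_vector_derivative_at_within G)
  then have "pot x = (\<lambda>t. G t - G 0)" by auto
  then show ?thesis
    using G[of s] by (auto intro!: derivative_eq_intros simp: has_real_derivative_iff_has_vector_derivative)
qed

text \<open>The mean value theorem, on the side where \<open>b\<close> lies, gives a slope
  \<open>f x z\<close>, which monotonicity compares with the slope at \<open>a\<close>.\<close>

lemma pot_subgradient: "pot x a + f x a * (b - a) \<le> pot x b"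
proof (cases a b rule: linorder_cases)
  case less
  obtain z where "a < z" "z < b" "pot x b - pot x a = (b - a) * f x z"
    using MVT2[OF less pot_deriv] by blast
  then show ?thesis
    using mult_left_mono[OF monoD[OF f_mono[of x], of a z], of "b - a"] less by (simp add: algebra_simps)
next
  case greater
  obtain z where "b < z" "z < a" "pot x a - pot x b = (a - b) * f x z"
    using MVT2[OF greater pot_deriv] by blast
  then show ?thesis
    using mult_left_mono[OF monoD[OF f_mono[of x], of z a], of "a - b"] greater by (simp add: algebra_simps)
qed simp

lemma pot_nonneg: "0 \<le> pot x s"
  using pot_subgradient[of x 0 s] by simp

lemma F_pot: "F x s = ennreal (pot x s)"
  by (simp add: F_eq pot_def)

lemma pot_minus [simp]: "pot x (- s) = pot x s"
proof -
  have "((\<lambda>t. pot x t - pot x (- t)) has_real_derivative 0) (at t)" for t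
    by (auto intro!: derivative_eq_intros DERIV_chain2[OF pot_deriv] simp: f_odd)
  from DERIV_isconst_all[of "\<lambda>t. pot x t - pot x (- t)" s 0] this show ?thesis by simp
qed

lemma f_nonneg: "0 \<le> s \<Longrightarrow> 0 \<le> f x s"
  using monoD[OF f_mono[of x], of 0 s] by simp

lemma pot_abs: "pot x \<bar>s\<bar> = pot x s"
  by (simp add: abs_if)

lemma f_abs: "\<bar>f x s\<bar> = f x \<bar>s\<bar>"
  using f_nonneg[of s x] f_nonneg[of "- s" x] by (auto simp: abs_if f_odd)

lemma pot_mono_abs: "\<bar>a\<bar> \<le> \<bar>b\<bar> \<Longrightarrow> pot x a \<le> pot x b"
  using pot_subgradient[of x "\<bar>a\<bar>" "\<bar>b\<bar>"] mult_nonneg_nonneg[OF f_nonneg[of "\<bar>a\<bar>" x], of "\<bar>b\<bar> - \<bar>a\<bar>"]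
  by (simp add: pot_abs)

text \<open>Average the two supporting-line inequalities at the intermediate point \<open>m\<close>;
  the linear terms cancel.\<close>

lemma pot_convex:
  assumes "0 \<le> c" "c \<le> 1"
  shows "pot x (c * a + (1 - c) * b) \<le> c * pot x a + (1 - c) * pot x b"
proof -
  define m where "m = c * a + (1 - c) * b"
  have "c * (pot x m + f x m * (a - m)) + (1 - c) * (pot x m + f x m * (b - m)) 
      \<le> c * pot x a + (1 - c) * pot x b"
    using assms by (intro add_mono mult_left_mono pot_subgradient) auto
  moreover have "c * (pot x m + f x m * (a - m)) + (1 - c) * (pot x m + f x m * (b - m)) = 
      pot x m + f x m * (c * a + (1 - c) * b - m)"
    by (simp add: algebra_simps)
  ultimately show ?thesis by (simp add: m_def)
qed

lemma pot_of_abs_le_max: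
  assumes "\<bar>c\<bar> \<le> max \<bar>a\<bar> \<bar>b\<bar>"
  shows "pot x c \<le> pot x a + pot x b"
proof (cases "\<bar>a\<bar> \<le> \<bar>b\<bar>")
  case True
  with assms show ?thesis using pot_mono_abs[of c b x] pot_nonneg[of x a] by (simp add: max_def)
next
  case False
  with assms show ?thesis using pot_mono_abs[of c a x] pot_nonneg[of x b] by (simp add: max_def)
qed

lemma f_times_self_le: "f x s * s \<le> pot x (2 * s)"
  using pot_subgradient[of x s "2 * s"] pot_nonneg[of x s] by simp

text \<open>Plays the part of Young's inequality. Both factors are replaced by their values at the
  larger of the two moduli, and \<open>f_times_self_le\<close> bounds the resulting product by the
  potential at twice that modulus.\<close>

lemma abs_f_times_le: "\<bar>f x a * b\<bar> \<le> pot x (2 * a) + pot x (2 * b)"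
proof -
  have "\<bar>f x a * b\<bar> \<le> f x (max \<bar>a\<bar> \<bar>b\<bar>) * max \<bar>a\<bar> \<bar>b\<bar>"
    unfolding abs_mult f_abs
    by (intro mult_mono monoD[OF f_mono] f_nonneg) auto
  also have "\<dots> \<le> pot x (2 * max \<bar>a\<bar> \<bar>b\<bar>)"
    by (rule f_times_self_le)
  also have "\<dots> \<le> pot x (2 * a) + pot x (2 * b)"
    by (rule pot_of_abs_le_max) auto
  finally show ?thesis .
qed

section \<open>Measurability and functions of finite modular\<close>

lemma pot_measurable: "w \<in> borel_measurable M \<Longrightarrow> (\<lambda>x. pot x (w x)) \<in> borel_measurable M"
proof (rule borel_measurable_caratheodory[where g = pot])
  show "continuous_on UNIV (pot x)" for x
    using pot_deriv by (meson DERIV_continuous continuous_at_imp_continuous_on)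
  show "(\<lambda>x. pot x s) \<in> borel_measurable M" for s
    using borel_measurable_enn2real[OF F_measurable[of s]] by (simp add: F_pot pot_nonneg)
qed

lemma f_comp_measurable: "w \<in> borel_measurable M \<Longrightarrow> (\<lambda>x. f x (w x)) \<in> borel_measurable M"
  by (rule borel_measurable_caratheodory[OF f_measurable f_cont])

text \<open>The doubling condition makes this set a linear space and lets the scale parameter of the
  Musielak-Orlicz definition be fixed at 1, see \<open>finite_modular_scaled\<close>.\<close>

definition finite_modular :: "('c \<Rightarrow> real) set" where
  "finite_modular = {w \<in> borel_measurable M. integrable M (\<lambda>x. pot x (w x))}"

lemma finite_modular_measurable: "w \<in> finite_modular \<Longrightarrow> w \<in> borel_measurable M"
  and finite_modular_integrable: "w \<in> finite_modular \<Longrightarrow> integrable M (\<lambda>x. pot x (w x))"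
  by (auto simp: finite_modular_def)

lemma nn_integral_F:
  "w \<in> finite_modular \<Longrightarrow> (\<integral>\<^sup>+x. F x (w x) \<partial>M) = ennreal (LINT x|M. pot x (w x))"
  by (simp add: F_pot nn_integral_eq_integral pot_nonneg finite_modular_integrable)

lemma finite_modularI:
  "w \<in> borel_measurable M \<Longrightarrow> (\<integral>\<^sup>+x. F x (w x) \<partial>M) < \<infinity> \<Longrightarrow> w \<in> finite_modular"
  by (simp add: finite_modular_def integrable_iff_bounded F_pot pot_nonneg pot_measurable)

lemma finite_modular_le:
  assumes "w \<in> borel_measurable M" "integrable M g" "\<And>x. pot x (w x) \<le> g x"
  shows "w \<in> finite_modular"
proof -
  have "integrable M (\<lambda>x. pot x (w x))"
    by (rule Bochner_Integration.integrable_bound[OF assms(2) pot_measurable[OF assms(1)]])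
      (use assms(3) pot_nonneg in \<open>force intro: order_trans[OF _ abs_ge_self]\<close>)
  with assms show ?thesis by (simp add: finite_modular_def)
qed

lemma pot_double:
  obtains K h where "0 < K" "integrable M h" "\<And>x s. pot x (2 * s) \<le> K * pot x s + h x"
proof -
  obtain K h where K: "K > 0" and h: "integrable M h" "\<And>x. 0 \<le> h x"
    and le: "\<And>x s. F x (2 * s) \<le> ennreal K * F x s + ennreal (h x)"
    using F_delta2 unfolding delta2_def by blast
  have "pot x (2 * s) \<le> K * pot x s + h x" for x s
    using le[of x s] K h(2)[of x]
    by (simp add: pot_nonneg F_pot ennreal_mult[symmetric] ennreal_plus[symmetric] del: ennreal_plus)
  with K h(1) show ?thesis by (rule that)
qed

lemma finite_modular_double:
  assumes "w \<in> finite_modular" shows "(\<lambda>x. 2 * w x) \<in> finite_modular"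
proof -
  obtain K h where "0 < K" "integrable M h" "\<And>x s. pot x (2 * s) \<le> K * pot x s + h x"
    by (rule pot_double) blast
  then show ?thesis
    using assms
    by (intro finite_modular_le[where g = "\<lambda>x. K * pot x (w x) + h x"])
      (auto simp: finite_modular_def)
qed

text \<open>Doubling is iterated until \<open>2 ^ n\<close> exceeds the modulus of \<open>c\<close>;
  monotonicity of the potential in the modulus does the rest.\<close>

lemma finite_modular_scale:
  assumes w: "w \<in> finite_modular" shows "(\<lambda>x. c * w x) \<in> finite_modular"
proof -
  have pow: "(\<lambda>x. 2 ^ n * w x) \<in> finite_modular" for n
  proof (induction n)
    case (Suc n)
    then show ?case using finite_modular_double[OF Suc] by (simp add: mult.assoc)
  qed (use w in simp)
  obtain n where n: "\<bar>c\<bar> < 2 ^ n"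
    using real_arch_pow[of 2 "\<bar>c\<bar>"] by auto
  show ?thesis
  proof (rule finite_modular_le[OF _ finite_modular_integrable[OF pow[of n]]])
    show "(\<lambda>x. c * w x) \<in> borel_measurable M"
      using finite_modular_measurable[OF w] by measurable
    show "pot x (c * w x) \<le> pot x (2 ^ n * w x)" for x
      using n by (intro pot_mono_abs) (auto simp: abs_mult intro!: mult_right_mono)
  qed
qed

lemma finite_modular_abs_le_max:
  assumes "w \<in> finite_modular" "v \<in> finite_modular" "z \<in> borel_measurable M"
    and "\<And>x. \<bar>z x\<bar> \<le> max \<bar>w x\<bar> \<bar>v x\<bar>"
  shows "z \<in> finite_modular"
proof (rule finite_modular_le)
  show "integrable M (\<lambda>x. pot x (w x) + pot x (v x))"
    using assms by (auto intro: finite_modular_integrable)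
qed (use assms in \<open>auto intro: pot_of_abs_le_max\<close>)

text \<open>The sum is bounded in modulus by the larger of the moduli of \<open>2 * w x\<close> and
  \<open>2 * v x\<close>.\<close>

lemma finite_modular_add:
  assumes "w \<in> finite_modular" "v \<in> finite_modular"
  shows "(\<lambda>x. w x + v x) \<in> finite_modular"
  using finite_modular_double[OF assms(1)] finite_modular_double[OF assms(2)]
proof (rule finite_modular_abs_le_max)
  show "(\<lambda>x. w x + v x) \<in> borel_measurable M"
    using assms[THEN finite_modular_measurable] by measurable
qed auto

lemma finite_modular_lincomb:
  assumes "w \<in> finite_modular" "v \<in> finite_modular"
  shows "(\<lambda>x. w x + c * v x) \<in> finite_modular"
  by (intro finite_modular_add finite_modular_scale assms)

lemma finite_modular_scaled:
  assumes "w \<in> borel_measurable M" "0 < l" "(\<integral>\<^sup>+x. F x (w x / l) \<partial>M) < \<infinity>"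
  shows "w \<in> finite_modular"
proof -
  have "(\<lambda>x. w x / l) \<in> finite_modular"
    using assms by (intro finite_modularI) auto
  from finite_modular_scale[OF this, of l] show ?thesis using assms(2) by simp
qed

section \<open>Pairing the derivative with a direction\<close>

lemma integrable_f_times:
  assumes w: "w \<in> finite_modular" and v: "v \<in> finite_modular"
  shows "integrable M (\<lambda>x. f x (w x) * v x)"
proof (rule Bochner_Integration.integrable_bound)
  show "integrable M (\<lambda>x. pot x (2 * w x) + pot x (2 * v x))"
    by (intro Bochner_Integration.integrable_add finite_modular_integrable finite_modular_double assms)
  show "(\<lambda>x. f x (w x) * v x) \<in> borel_measurable M"
    using f_comp_measurable assms[THEN finite_modular_measurable] by measurable
  show "AE x in M. norm (f x (w x) * v x) \<le> norm (pot x (2 * w x) + pot x (2 * v x))"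
    using order_trans[OF abs_f_times_le abs_ge_self] by simp
qed

lemma integral_pot_subgradient:
  assumes w: "w \<in> finite_modular" and v: "v \<in> finite_modular"
  shows "(LINT x|M. pot x (w x)) + (LINT x|M. f x (w x) * v x) \<le> (LINT x|M. pot x (w x + v x))"
proof -
  have "(LINT x|M. pot x (w x) + f x (w x) * v x) \<le> (LINT x|M. pot x (w x + v x))"
  proof (rule integral_mono)
    show "pot x (w x) + f x (w x) * v x \<le> pot x (w x + v x)" for x
      using pot_subgradient[of x "w x" "w x + v x"] by simp
  qed (auto intro!: Bochner_Integration.integrable_add integrable_f_times finite_modular_integrable
      finite_modular_add w v)
  then show ?thesis
    by (simp add: integrable_f_times finite_modular_integrable w v)
qed

text \<open>Dominated convergence. The step sizes start at 1, so every argument of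
  \<open>f x\<close> has modulus at most \<open>?z x\<close>, and \<open>f x (?z x) * ?z x\<close>
  is an integrable bound independent of \<open>n\<close>.\<close>

lemma tendsto_integral_f_times:
  assumes w: "w \<in> finite_modular" and v: "v \<in> finite_modular"
  shows "(\<lambda>n. LINT x|M. f x (w x + 1 / real (Suc n) * v x) * v x) \<longlonglongrightarrow> (LINT x|M. f x (w x) * v x)"
proof (rule integral_dominated_convergence)
  let ?z = "\<lambda>x. \<bar>w x\<bar> + \<bar>v x\<bar>"
  have [measurable]: "w \<in> borel_measurable M" "v \<in> borel_measurable M"
    using w v by (auto intro: finite_modular_measurable)
  have "(\<lambda>x. \<bar>w x\<bar>) \<in> finite_modular" "(\<lambda>x. \<bar>v x\<bar>) \<in> finite_modular"
    by (rule finite_modular_abs_le_max[OF w w] finite_modular_abs_le_max[OF v v]; simp; fail)+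
  then have z: "?z \<in> finite_modular" by (rule finite_modular_add)
  show "integrable M (\<lambda>x. f x (?z x) * ?z x)"
    by (rule integrable_f_times[OF z z])
  show "(\<lambda>x. f x (w x) * v x) \<in> borel_measurable M"
    by (intro borel_measurable_times f_comp_measurable) measurable
  show "(\<lambda>x. f x (w x + 1 / real (Suc n) * v x) * v x) \<in> borel_measurable M" for n
    by (intro borel_measurable_times f_comp_measurable) measurable
  show "AE x in M. (\<lambda>n. f x (w x + 1 / real (Suc n) * v x) * v x) \<longlonglongrightarrow> f x (w x) * v x"
  proof (intro AE_I2 tendsto_mult tendsto_const)
    fix x
    have "(\<lambda>n. w x + 1 / real (Suc n) * v x) \<longlonglongrightarrow> w x"
      using tendsto_add[OF tendsto_const tendsto_mult[OF LIMSEQ_Suc[OF lim_1_over_n] tendsto_const], of "w x" "v x"]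
      by simp
    then show "(\<lambda>n. f x (w x + 1 / real (Suc n) * v x)) \<longlonglongrightarrow> f x (w x)"
      by (rule isCont_tendsto_compose[where g = "f x", rotated])
        (use f_cont[of x] in \<open>simp add: continuous_on_eq_continuous_at\<close>)
  qed
  show "AE x in M. norm (f x (w x + 1 / real (Suc n) * v x) * v x) \<le> f x (?z x) * ?z x" for n
  proof (intro AE_I2)
    fix x
    have "\<bar>w x + 1 / real (Suc n) * v x\<bar> \<le> ?z x"
      using mult_right_mono[of "1 / real (Suc n)" 1 "\<bar>v x\<bar>"]
      by (intro order_trans[OF abs_triangle_ineq] add_left_mono) (auto simp: abs_mult)
    then have "f x \<bar>w x + 1 / real (Suc n) * v x\<bar> * \<bar>v x\<bar> \<le> f x (?z x) * ?z x"
      by (intro mult_mono monoD[OF f_mono] f_nonneg) auto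
    then show "norm (f x (w x + 1 / real (Suc n) * v x) * v x) \<le> f x (?z x) * ?z x"
      by (simp only: real_norm_def abs_mult f_abs)
  qed
qed

end

section \<open>The Sobolev-type space\<close>

lemma abs_max_diff_le:
  fixes a b c d :: real
  shows "\<bar>max a b - max c d\<bar> \<le> max \<bar>a - c\<bar> \<bar>b - d\<bar>"
  by (auto simp: max_def)

lemma max_square_le:
  fixes a b :: real
  shows "(max a b)\<^sup>2 \<le> a\<^sup>2 + b\<^sup>2"
  by (auto simp: max_def)

text \<open>The second potential lives on the completion because quasi-continuous representatives
  are shown to be measurable there, in \<open>quasi_continuous_measurable\<close>.\<close>

locale perturbed_energy =
  fixes \<mu> :: "'a::topological_space measure"
    and \<Omega> :: "'a set"
    and \<Phi> :: "'a \<Rightarrow> 'a \<Rightarrow> real \<Rightarrow> ennreal"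
    and \<phi> :: "'a \<Rightarrow> 'a \<Rightarrow> real \<Rightarrow> real"
    and \<iota> :: "'a \<Rightarrow> 'b::topological_space"
    and \<nu> :: "'b measure"
    and B :: "'b \<Rightarrow> real \<Rightarrow> ennreal"
    and \<beta> :: "'b \<Rightarrow> real \<Rightarrow> real"
  assumes mu_borel: "sets \<mu> = sets borel"
    and mu_sigma_finite: "sigma_finite_measure \<mu>"
    and Omega_borel: "\<Omega> \<in> sets borel"
    and iota_cont: "continuous_on UNIV \<iota>"
    and nu_borel: "sets \<nu> = sets borel"
    and nu_abs_continuous: "cap_abs_continuous \<mu> \<Omega> \<Phi> \<iota> \<nu>"
    and Phi_potential: "potential (\<mu> \<Otimes>\<^sub>M \<mu>) (\<lambda>p. \<Phi> (fst p) (snd p)) (\<lambda>p. \<phi> (fst p) (snd p))"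
    and B_potential: "potential (completion \<nu>) B \<beta>"
begin

sublocale pair_sigma_finite \<mu> \<mu>
  using mu_sigma_finite by (simp add: pair_sigma_finite_def)

sublocale E: potential "\<mu> \<Otimes>\<^sub>M \<mu>" "\<lambda>p. \<Phi> (fst p) (snd p)" "\<lambda>p. \<phi> (fst p) (snd p)"
  by (rule Phi_potential)

sublocale P: potential "completion \<nu>" B \<beta>
  by (rule B_potential)

lemma space_mu [simp]: "space \<mu> = UNIV"
  using sets_eq_imp_space_eq[OF mu_borel] by simp

lemma space_nu [simp]: "space \<nu> = UNIV"
  using sets_eq_imp_space_eq[OF nu_borel] by simp

lemma Omega_sets [measurable]: "\<Omega> \<in> sets \<mu>"
  by (simp add: mu_borel Omega_borel)

lemma iota_measurable [measurable]: "\<iota> \<in> measurable \<mu> borel"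
  using borel_measurable_continuous_onI[OF iota_cont] by (simp cong: measurable_cong_sets[OF mu_borel refl])

text \<open>Being linear in \<open>u\<close>, it turns the nonlocal modular into an ordinary modular
  for the potential \<open>E\<close> on the product space.\<close>

definition incr :: "('a \<Rightarrow> real) \<Rightarrow> 'a \<times> 'a \<Rightarrow> real" where
  "incr u p = u (fst p) - u (snd p)"

lemma incr_lincomb: "incr (\<lambda>x. u x + c * v x) = (\<lambda>p. incr u p + c * incr v p)"
  by (auto simp: incr_def algebra_simps)

lemma incr_measurable [measurable]:
  assumes [measurable]: "u \<in> borel_measurable \<mu>"
  shows "incr u \<in> borel_measurable (\<mu> \<Otimes>\<^sub>M \<mu>)"
  unfolding incr_def by measurable

lemma modular_pair:
  assumes [measurable]: "u \<in> borel_measurable \<mu>"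
  shows "modular \<mu> \<Phi> u l = (\<integral>\<^sup>+p. \<Phi> (fst p) (snd p) (incr u p / l) \<partial>(\<mu> \<Otimes>\<^sub>M \<mu>))"
proof -
  have "(\<lambda>p. \<Phi> (fst p) (snd p) (incr u p / l)) \<in> borel_measurable (\<mu> \<Otimes>\<^sub>M \<mu>)"
    unfolding E.F_pot by (intro measurable_compose[OF _ measurable_ennreal] E.pot_measurable) measurable
  from sigma_finite_measure.nn_integral_fst[OF mu_sigma_finite this] show ?thesis
    by (simp add: modular_def incr_def)
qed

text \<open>Doubling absorbs the scale: a modular that is finite at one scale is finite at scale
  1.\<close>

lemma W0_iff: "u \<in> W0 \<mu> \<Phi> \<longleftrightarrow> u \<in> borel_measurable \<mu> \<and> incr u \<in> E.finite_modular"
proof safe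
  assume "u \<in> W0 \<mu> \<Phi>"
  then obtain l where u: "u \<in> borel_measurable \<mu>" and "l > 0" "modular \<mu> \<Phi> u l < \<infinity>"
    by (auto simp: W0_def)
  then show "u \<in> borel_measurable \<mu>" "incr u \<in> E.finite_modular"
    by (auto simp: modular_pair intro!: E.finite_modular_scaled[of _ l])
next
  assume u: "u \<in> borel_measurable \<mu>" "incr u \<in> E.finite_modular"
  have "modular \<mu> \<Phi> u 1 < \<infinity>"
    unfolding modular_pair[OF u(1)] by (simp add: E.nn_integral_F u)
  with u show "u \<in> W0 \<mu> \<Phi>"
    by (auto simp: W0_def intro!: exI[of _ 1])
qed

lemma modular_eq:
  assumes "u \<in> W0 \<mu> \<Phi>"
  shows "modular \<mu> \<Phi> u l = ennreal (LINT p|(\<mu> \<Otimes>\<^sub>M \<mu>). E.pot p (incr u p / l))"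
proof -
  have u: "u \<in> borel_measurable \<mu>" and fin: "incr u \<in> E.finite_modular"
    using assms by (auto simp: W0_iff)
  have "(\<lambda>p. incr u p / l) \<in> E.finite_modular"
    using E.finite_modular_scale[OF fin, of "1 / l"] by simp
  from E.nn_integral_F[OF this] show ?thesis
    by (simp add: modular_pair u)
qed

lemma energy_eq:
  assumes "u \<in> W0 \<mu> \<Phi>"
  shows "energy \<mu> \<Phi> u = ennreal (1/2 * (LINT p|(\<mu> \<Otimes>\<^sub>M \<mu>). E.pot p (incr u p)))"
proof -
  have "energy \<mu> \<Phi> u = modular \<mu> \<Phi> u 1 / 2"
    by (simp add: energy_def modular_def)
  also have "\<dots> = ennreal (LINT p|(\<mu> \<Otimes>\<^sub>M \<mu>). E.pot p (incr u p)) / ennreal 2"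
    by (simp add: modular_eq[OF assms])
  also have "\<dots> = ennreal (1/2 * (LINT p|(\<mu> \<Otimes>\<^sub>M \<mu>). E.pot p (incr u p)))"
    by (subst divide_ennreal) (auto simp: E.pot_nonneg)
  finally show ?thesis .
qed

lemma L2_measurable: "f \<in> L2 \<mu> \<Omega> \<Longrightarrow> (\<lambda>x. indicator \<Omega> x * f x) \<in> borel_measurable \<mu>"
  by (simp add: L2_def set_borel_measurable_def)

lemma L2_integrable: "f \<in> L2 \<mu> \<Omega> \<Longrightarrow> integrable \<mu> (\<lambda>x. indicator \<Omega> x * (f x)\<^sup>2)"
  by (simp add: L2_def set_integrable_def)

lemma L2_iff:
  "u \<in> borel_measurable \<mu> \<Longrightarrow> u \<in> L2 \<mu> \<Omega> \<longleftrightarrow> integrable \<mu> (\<lambda>x. indicator \<Omega> x * (u x)\<^sup>2)"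
  by (simp add: L2_def set_borel_measurable_def set_integrable_def)

lemma L2_times_integrable:
  assumes "f \<in> L2 \<mu> \<Omega>" "g \<in> L2 \<mu> \<Omega>"
  shows "set_integrable \<mu> \<Omega> (\<lambda>x. f x * g x)"
  unfolding set_integrable_def
proof (rule Bochner_Integration.integrable_bound)
  show "integrable \<mu> (\<lambda>x. indicator \<Omega> x * (f x)\<^sup>2 + indicator \<Omega> x * (g x)\<^sup>2)"
    using assms by (intro Bochner_Integration.integrable_add L2_integrable)
  \<comment> \<open>Membership in \<open>L2\<close> gives measurability only after cutting off to
    \<open>\<Omega>\<close>, so the indicator is attached to each factor.\<close>
  have "(\<lambda>x. indicat_real \<Omega> x *\<^sub>R (f x * g x)) = (\<lambda>x. (indicator \<Omega> x * f x) * (indicator \<Omega> x * g x))"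
    by (auto simp: indicator_def)
  then show "(\<lambda>x. indicat_real \<Omega> x *\<^sub>R (f x * g x)) \<in> borel_measurable \<mu>"
    using borel_measurable_times[OF assms[THEN L2_measurable]] by simp
  have "\<bar>a * b\<bar> \<le> a\<^sup>2 + b\<^sup>2" for a b :: real
  proof -
    have "0 \<le> (\<bar>a\<bar> - \<bar>b\<bar>)\<^sup>2" by simp
    then have "2 * \<bar>a * b\<bar> \<le> a\<^sup>2 + b\<^sup>2" by (simp add: power2_diff abs_mult)
    then show ?thesis using abs_ge_zero[of "a * b"] by linarith
  qed
  then show "AE x in \<mu>. norm (indicat_real \<Omega> x *\<^sub>R (f x * g x))
      \<le> norm (indicator \<Omega> x * (f x)\<^sup>2 + indicator \<Omega> x * (g x)\<^sup>2)"
    by (auto simp: indicator_def)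
qed

lemma W2_measurable: "u \<in> W2 \<mu> \<Omega> \<Phi> \<Longrightarrow> u \<in> borel_measurable \<mu>"
  by (simp add: W2_def W0_iff)

lemma W2_L2: "u \<in> W2 \<mu> \<Omega> \<Phi> \<Longrightarrow> u \<in> L2 \<mu> \<Omega>"
  and W2_W0: "u \<in> W2 \<mu> \<Omega> \<Phi> \<Longrightarrow> u \<in> W0 \<mu> \<Phi>"
  and W2_incr: "u \<in> W2 \<mu> \<Omega> \<Phi> \<Longrightarrow> incr u \<in> E.finite_modular"
  by (simp_all add: W2_def W0_iff)

lemma W2I:
  "u \<in> borel_measurable \<mu> \<Longrightarrow> incr u \<in> E.finite_modular \<Longrightarrow>
    integrable \<mu> (\<lambda>x. indicator \<Omega> x * (u x)\<^sup>2) \<Longrightarrow> u \<in> W2 \<mu> \<Omega> \<Phi>"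
  by (simp add: W2_def W0_iff L2_iff)

lemma W2_lincomb:
  assumes u: "u \<in> W2 \<mu> \<Omega> \<Phi>" and v: "v \<in> W2 \<mu> \<Omega> \<Phi>"
  shows "(\<lambda>x. u x + c * v x) \<in> W2 \<mu> \<Omega> \<Phi>"
proof (rule W2I)
  have [measurable]: "u \<in> borel_measurable \<mu>" "v \<in> borel_measurable \<mu>"
    using u v by (auto intro: W2_measurable)
  show "(\<lambda>x. u x + c * v x) \<in> borel_measurable \<mu>" by measurable
  show "incr (\<lambda>x. u x + c * v x) \<in> E.finite_modular"
    unfolding incr_lincomb by (intro E.finite_modular_lincomb W2_incr u v)
  have "integrable \<mu> (\<lambda>x. indicator \<Omega> x * (u x)\<^sup>2 + 2 * c * (indicator \<Omega> x * (u x * v x)) +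
      c\<^sup>2 * (indicator \<Omega> x * (v x)\<^sup>2))"
    using L2_times_integrable[OF W2_L2 W2_L2, OF u v] u v
    by (intro Bochner_Integration.integrable_add integrable_mult_right L2_integrable W2_L2)
      (simp_all add: set_integrable_def)
  moreover have "(\<lambda>x. indicator \<Omega> x * (u x)\<^sup>2 + 2 * c * (indicator \<Omega> x * (u x * v x)) +
      c\<^sup>2 * (indicator \<Omega> x * (v x)\<^sup>2)) = (\<lambda>x. indicator \<Omega> x * (u x + c * v x)\<^sup>2)"
    by (auto simp: power2_eq_square algebra_simps)
  ultimately show "integrable \<mu> (\<lambda>x. indicator \<Omega> x * (u x + c * v x)\<^sup>2)" by simp
qed

text \<open>An increment of the maximum is bounded by the larger of the two increments. This is used
  for capacities: the maximum of competitors for two sets competes for their union.\<close>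

lemma W2_max:
  assumes u: "u \<in> W2 \<mu> \<Omega> \<Phi>" and v: "v \<in> W2 \<mu> \<Omega> \<Phi>"
  shows "(\<lambda>x. max (u x) (v x)) \<in> W2 \<mu> \<Omega> \<Phi>"
proof (rule W2I)
  have [measurable]: "u \<in> borel_measurable \<mu>" "v \<in> borel_measurable \<mu>"
    using u v by (auto intro: W2_measurable)
  show "(\<lambda>x. max (u x) (v x)) \<in> borel_measurable \<mu>" by measurable
  show "incr (\<lambda>x. max (u x) (v x)) \<in> E.finite_modular"
    by (rule E.finite_modular_abs_le_max[OF W2_incr[OF u] W2_incr[OF v]])
      (measurable, simp add: incr_def abs_max_diff_le)
  show "integrable \<mu> (\<lambda>x. indicator \<Omega> x * (max (u x) (v x))\<^sup>2)"
  proof (rule Bochner_Integration.integrable_bound)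
    show "integrable \<mu> (\<lambda>x. indicator \<Omega> x * (u x)\<^sup>2 + indicator \<Omega> x * (v x)\<^sup>2)"
      using u v by (intro Bochner_Integration.integrable_add L2_integrable W2_L2)
  qed (measurable, auto simp: indicator_def max_square_le)
qed

section \<open>The Luxemburg seminorm of a maximum\<close>

lemma W0_norm_bdd: "bdd_below {l. 0 < l \<and> modular \<mu> \<Phi> u l \<le> 1}"
  by (rule bdd_belowI[of _ 0]) auto

text \<open>Convexity between \<open>s\<close> and 0, where the potential vanishes.\<close>

lemma pot_divide_le: "1 \<le> k \<Longrightarrow> E.pot p (s / k) \<le> E.pot p s / k"
  using E.pot_convex[of "1 / k" p s 0] by simp

lemma W0_pot_integrable:
  assumes "u \<in> W0 \<mu> \<Phi>"
  shows "integrable (\<mu> \<Otimes>\<^sub>M \<mu>) (\<lambda>p. E.pot p (incr u p / l))"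
  using E.finite_modular_integrable[OF E.finite_modular_scale[of "incr u" "1 / l"]] assms
  by (simp add: W0_iff)

lemma modular_divide_le:
  assumes u: "u \<in> W0 \<mu> \<Phi>" and "1 \<le> k"
  shows "modular \<mu> \<Phi> u (l * k) \<le> modular \<mu> \<Phi> u l / ennreal k"
proof -
  have "(LINT p|(\<mu> \<Otimes>\<^sub>M \<mu>). E.pot p (incr u p / (l * k))) \<le> (LINT p|(\<mu> \<Otimes>\<^sub>M \<mu>). E.pot p (incr u p / l) / k)"
    using pot_divide_le[OF \<open>1 \<le> k\<close>, of _ "incr u _ / l"]
    by (intro integral_mono W0_pot_integrable integrable_divide u) simp
  then have "(LINT p|(\<mu> \<Otimes>\<^sub>M \<mu>). E.pot p (incr u p / (l * k))) \<le> (LINT p|(\<mu> \<Otimes>\<^sub>M \<mu>). E.pot p (incr u p / l)) / k"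
    by simp
  then show ?thesis
    using \<open>1 \<le> k\<close> by (simp add: modular_eq[OF u] divide_ennreal E.pot_nonneg ennreal_leI)
qed

text \<open>A scale \<open>k\<close> that exceeds both 1 and the modular at scale 1 brings the
  modular down to at most 1. Nonemptiness keeps the real \<open>Inf\<close> in
  \<open>W0_norm\<close> away from its default value.\<close>

lemma W0_norm_nonempty:
  assumes u: "u \<in> W0 \<mu> \<Phi>"
  shows "{l. 0 < l \<and> modular \<mu> \<Phi> u l \<le> 1} \<noteq> {}"
proof -
  define k where "k = max 1 (LINT p|(\<mu> \<Otimes>\<^sub>M \<mu>). E.pot p (incr u p / 1))"
  have k: "1 \<le> k" by (simp add: k_def)
  have "modular \<mu> \<Phi> u (1 * k) \<le> modular \<mu> \<Phi> u 1 / ennreal k"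
    by (rule modular_divide_le[OF u k])
  also have "\<dots> \<le> 1"
    unfolding modular_eq[OF u] using k
    by (subst divide_ennreal) (auto simp: E.pot_nonneg divide_le_eq_1 k_def)
  finally show ?thesis using k by (auto intro!: exI[of _ k])
qed

lemma W0_norm_nonneg: "u \<in> W0 \<mu> \<Phi> \<Longrightarrow> 0 \<le> W0_norm \<mu> \<Phi> u"
  unfolding W0_norm_def by (rule cInf_greatest[OF W0_norm_nonempty]) auto

lemma modular_max_le:
  assumes u: "u \<in> W0 \<mu> \<Phi>" and v: "v \<in> W0 \<mu> \<Phi>" and m: "(\<lambda>x. max (u x) (v x)) \<in> W0 \<mu> \<Phi>" and "0 < l"
  shows "modular \<mu> \<Phi> (\<lambda>x. max (u x) (v x)) l \<le> modular \<mu> \<Phi> u l + modular \<mu> \<Phi> v l"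
proof -
  have "(LINT p|(\<mu> \<Otimes>\<^sub>M \<mu>). E.pot p (incr (\<lambda>x. max (u x) (v x)) p / l))
      \<le> (LINT p|(\<mu> \<Otimes>\<^sub>M \<mu>). E.pot p (incr u p / l) + E.pot p (incr v p / l))"
  proof (intro integral_mono W0_pot_integrable Bochner_Integration.integrable_add u v m)
    fix p
    have "\<bar>incr (\<lambda>x. max (u x) (v x)) p\<bar> \<le> max \<bar>incr u p\<bar> \<bar>incr v p\<bar>"
      by (simp add: incr_def abs_max_diff_le)
    then have "\<bar>incr (\<lambda>x. max (u x) (v x)) p\<bar> / l \<le> max \<bar>incr u p\<bar> \<bar>incr v p\<bar> / l"
      using \<open>0 < l\<close> by (simp add: divide_right_mono)
    then show "E.pot p (incr (\<lambda>x. max (u x) (v x)) p / l) \<le> E.pot p (incr u p / l) + E.pot p (incr v p / l)"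
      using \<open>0 < l\<close> by (intro E.pot_of_abs_le_max) (simp add: max_divide_distrib_right)
  qed
  then show ?thesis
    by (simp add: modular_eq u v m W0_pot_integrable E.pot_nonneg ennreal_plus[symmetric] ennreal_leI del: ennreal_plus)
qed

text \<open>Take nearly optimal scales \<open>k\<close> and \<open>l\<close>. At scale
  \<open>2 * (k + l)\<close> each of the two modulars is at most 1/2 by convexity, so that of the
  maximum is at most 1.\<close>

lemma W0_norm_max_le:
  assumes u: "u \<in> W0 \<mu> \<Phi>" and v: "v \<in> W0 \<mu> \<Phi>" and m: "(\<lambda>x. max (u x) (v x)) \<in> W0 \<mu> \<Phi>"
  shows "W0_norm \<mu> \<Phi> (\<lambda>x. max (u x) (v x)) \<le> 2 * (W0_norm \<mu> \<Phi> u + W0_norm \<mu> \<Phi> v)"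
proof (rule field_le_epsilon)
  fix e :: real assume "0 < e"
  \<comment> \<open>Two slacks of \<open>e / 4\<close>, doubled in the scale
    \<open>2 * (k + l)\<close>, add up to \<open>e\<close>.\<close>
  have ex: "\<exists>l. l < W0_norm \<mu> \<Phi> w + e / 4 \<and> 0 < l \<and> modular \<mu> \<Phi> w l \<le> 1" if w: "w \<in> W0 \<mu> \<Phi>" for w
    using cInf_lessD[OF W0_norm_nonempty[OF w], of "W0_norm \<mu> \<Phi> w + e / 4"] \<open>0 < e\<close>
    by (auto simp: W0_norm_def)
  obtain k l where k: "k < W0_norm \<mu> \<Phi> u + e / 4" "0 < k" "modular \<mu> \<Phi> u k \<le> 1"
    and l: "l < W0_norm \<mu> \<Phi> v + e / 4" "0 < l" "modular \<mu> \<Phi> v l \<le> 1"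
    using ex[OF u] ex[OF v] by blast
  have half: "modular \<mu> \<Phi> w (2 * (k + l)) \<le> ennreal (1/2)"
    if w: "w \<in> W0 \<mu> \<Phi>" "modular \<mu> \<Phi> w r \<le> 1" and r: "0 < r" "r \<le> k + l" for w r
  proof -
    have "modular \<mu> \<Phi> w (r * (2 * (k + l) / r)) \<le> modular \<mu> \<Phi> w r / ennreal (2 * (k + l) / r)"
      using r by (intro modular_divide_le[OF w(1)]) (simp add: field_simps)
    also have "\<dots> \<le> 1 / ennreal (2 * (k + l) / r)"
      by (rule divide_right_mono_ennreal[OF w(2)])
    also have "\<dots> = ennreal (1 / (2 * (k + l) / r))"
      using r by (subst ennreal_1[symmetric], subst divide_ennreal) auto
    also have "\<dots> \<le> ennreal (1/2)"
      using r by (intro ennreal_leI) (simp add: field_simps)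
    finally show ?thesis using r by simp
  qed
  have "modular \<mu> \<Phi> (\<lambda>x. max (u x) (v x)) (2 * (k + l)) \<le> ennreal (1/2) + ennreal (1/2)"
    using k l half[OF u k(3)] half[OF v l(3)]
    by (intro order_trans[OF modular_max_le[OF u v m]] add_mono) auto
  also have "\<dots> = 1"
    by (subst ennreal_plus[symmetric]) auto
  finally have "W0_norm \<mu> \<Phi> (\<lambda>x. max (u x) (v x)) \<le> 2 * (k + l)"
    unfolding W0_norm_def using k l by (intro cInf_lower W0_norm_bdd) auto
  with k l show "W0_norm \<mu> \<Phi> (\<lambda>x. max (u x) (v x)) \<le> 2 * (W0_norm \<mu> \<Phi> u + W0_norm \<mu> \<Phi> v) + e"
    by simp
qed

text \<open>The square of the norm and the sum of the squares of its two parts agree up to a factor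
  2. The seminorm estimate contributes the factor 8, hence 16.\<close>

lemma W2_norm_max_le:
  assumes u: "u \<in> W2 \<mu> \<Omega> \<Phi>" and v: "v \<in> W2 \<mu> \<Omega> \<Phi>"
  shows "(W2_norm \<mu> \<Omega> \<Phi> (\<lambda>x. max (u x) (v x)))\<^sup>2 \<le> 16 * ((W2_norm \<mu> \<Omega> \<Phi> u)\<^sup>2 + (W2_norm \<mu> \<Omega> \<Phi> v)\<^sup>2)"
proof -
  define m where "m x = max (u x) (v x)" for x
  have m: "m \<in> W2 \<mu> \<Omega> \<Phi>" unfolding m_def by (rule W2_max[OF u v])
  define a where "a w = (LINT x:\<Omega>|\<mu>. (w x)\<^sup>2)" for w :: "'a \<Rightarrow> real"
  define q where "q w = W0_norm \<mu> \<Phi> w" for w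
  have a0: "0 \<le> a w" for w
    unfolding a_def set_lebesgue_integral_def by (rule integral_nonneg_AE) (auto simp: indicator_def)
  have q0: "0 \<le> q u" "0 \<le> q v" "0 \<le> q m"
    unfolding q_def using u v m by (auto intro: W0_norm_nonneg W2_W0)
  have sq: "(W2_norm \<mu> \<Omega> \<Phi> w)\<^sup>2 = a w + (q w)\<^sup>2 + 2 * sqrt (a w) * q w" for w
    using a0[of w] by (simp add: W2_norm_def a_def q_def power2_sum)
  have "a m \<le> (LINT x|\<mu>. indicator \<Omega> x * (u x)\<^sup>2 + indicator \<Omega> x * (v x)\<^sup>2)"
    unfolding a_def set_lebesgue_integral_def real_scaleR_def
    by (intro integral_mono Bochner_Integration.integrable_add L2_integrable W2_L2 u v m)
      (auto simp: indicator_def m_def max_square_le)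
  also have "\<dots> = a u + a v"
    using u v by (simp add: a_def set_lebesgue_integral_def L2_integrable W2_L2)
  finally have am: "a m \<le> a u + a v" .
  have "q m \<le> 2 * (q u + q v)"
    using W0_norm_max_le[OF W2_W0[OF u] W2_W0[OF v]] W2_W0[OF m] by (simp add: q_def m_def[abs_def])
  then have "(q m)\<^sup>2 \<le> (2 * (q u + q v))\<^sup>2"
    using q0 by (intro power_mono) auto
  also have "\<dots> \<le> 8 * ((q u)\<^sup>2 + (q v)\<^sup>2)"
    using sum_squares_bound[of "q u" "q v"] by (simp add: power2_eq_square algebra_simps)
  finally have qm: "(q m)\<^sup>2 \<le> 8 * ((q u)\<^sup>2 + (q v)\<^sup>2)" .
  have "(W2_norm \<mu> \<Omega> \<Phi> m)\<^sup>2 \<le> 2 * a m + 2 * (q m)\<^sup>2"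
    using sum_squares_bound[of "sqrt (a m)" "q m"] a0[of m] unfolding sq by simp
  also have "\<dots> \<le> 2 * (a u + a v) + 16 * ((q u)\<^sup>2 + (q v)\<^sup>2)"
    using am qm by simp
  also have "\<dots> \<le> 16 * ((W2_norm \<mu> \<Omega> \<Phi> u)\<^sup>2 + (W2_norm \<mu> \<Omega> \<Phi> v)\<^sup>2)"
    using a0[of u] a0[of v] q0 unfolding sq by (simp add: algebra_simps)
  finally show ?thesis by (simp add: m_def[abs_def])
qed

subsection \<open>Capacity and quasi-continuous representatives\<close>

lemma vimage_sets: "open U \<Longrightarrow> \<iota> -` U - \<Omega> \<in> sets \<mu>"
  using measurable_sets[OF iota_measurable, of U] by auto

lemma Cap_lessE:
  assumes "Cap \<mu> \<Omega> \<Phi> \<iota> A < c"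
  obtains w U where "w \<in> W2 \<mu> \<Omega> \<Phi>" "open U" "A \<subseteq> U" "AE x in \<mu>. \<iota> x \<in> U \<longrightarrow> 1 \<le> w x"
    "ennreal ((W2_norm \<mu> \<Omega> \<Phi> w)\<^sup>2) + emeasure \<mu> (\<iota> -` A - \<Omega>) < c"
  using assms unfolding Cap_def INF_less_iff by blast

lemma Cap_le:
  assumes "w \<in> W2 \<mu> \<Omega> \<Phi>" "open U" "A \<subseteq> U" "AE x in \<mu>. \<iota> x \<in> U \<longrightarrow> 1 \<le> w x"
  shows "Cap \<mu> \<Omega> \<Phi> \<iota> A \<le> ennreal ((W2_norm \<mu> \<Omega> \<Phi> w)\<^sup>2) + emeasure \<mu> (\<iota> -` A - \<Omega>)"
  unfolding Cap_def using assms by (intro INF_lower) auto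

lemma Cap_greatest:
  assumes "\<And>w U. w \<in> W2 \<mu> \<Omega> \<Phi> \<Longrightarrow> open U \<Longrightarrow> A \<subseteq> U \<Longrightarrow> AE x in \<mu>. \<iota> x \<in> U \<longrightarrow> 1 \<le> w x \<Longrightarrow>
    c \<le> ennreal ((W2_norm \<mu> \<Omega> \<Phi> w)\<^sup>2) + emeasure \<mu> (\<iota> -` A - \<Omega>)"
  shows "c \<le> Cap \<mu> \<Omega> \<Phi> \<iota> A"
  unfolding Cap_def using assms by (intro INF_greatest) blast

text \<open>Openness of \<open>U\<close> provides the measurable preimage that monotonicity of
  \<open>emeasure\<close> asks for; \<open>A\<close> may be arbitrary.\<close>

lemma Cap_mono:
  assumes "A \<subseteq> U" "open U"
  shows "Cap \<mu> \<Omega> \<Phi> \<iota> A \<le> Cap \<mu> \<Omega> \<Phi> \<iota> U"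
proof (rule Cap_greatest)
  fix w V assume "w \<in> W2 \<mu> \<Omega> \<Phi>" "open V" "U \<subseteq> V" "AE x in \<mu>. \<iota> x \<in> V \<longrightarrow> 1 \<le> w x"
  then have "Cap \<mu> \<Omega> \<Phi> \<iota> A \<le> ennreal ((W2_norm \<mu> \<Omega> \<Phi> w)\<^sup>2) + emeasure \<mu> (\<iota> -` A - \<Omega>)"
    using assms(1) by (intro Cap_le[of w V]) auto
  also have "\<dots> \<le> ennreal ((W2_norm \<mu> \<Omega> \<Phi> w)\<^sup>2) + emeasure \<mu> (\<iota> -` U - \<Omega>)"
    using assms by (intro add_left_mono emeasure_mono vimage_sets) auto
  finally show "Cap \<mu> \<Omega> \<Phi> \<iota> A \<le> ennreal ((W2_norm \<mu> \<Omega> \<Phi> w)\<^sup>2) + emeasure \<mu> (\<iota> -` U - \<Omega>)" .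
qed

text \<open>The maximum of two competitors competes for the union. The bound \<open>2 * e\<close>
  leaves room for competitors that miss the infimum, and 64 is 16, from the norm of the maximum,
  times \<open>2 + 2\<close>.\<close>

lemma Cap_Un_le:
  assumes U: "open U" "Cap \<mu> \<Omega> \<Phi> \<iota> U \<le> ennreal e" and V: "open V" "Cap \<mu> \<Omega> \<Phi> \<iota> V \<le> ennreal e"
    and e: "0 < e"
  shows "Cap \<mu> \<Omega> \<Phi> \<iota> (U \<union> V) \<le> ennreal (64 * e)"
proof -
  let ?N = "W2_norm \<mu> \<Omega> \<Phi>"
  have less: "ennreal e < ennreal (2 * e)"
    using e by (simp add: ennreal_less_iff)
  obtain u U' where u: "u \<in> W2 \<mu> \<Omega> \<Phi>" "open U'" "U \<subseteq> U'" "AE x in \<mu>. \<iota> x \<in> U' \<longrightarrow> 1 \<le> u x"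
    and cu: "ennreal ((?N u)\<^sup>2) + emeasure \<mu> (\<iota> -` U - \<Omega>) < ennreal (2 * e)"
    by (rule Cap_lessE[OF le_less_trans[OF U(2) less]])
  obtain v V' where v: "v \<in> W2 \<mu> \<Omega> \<Phi>" "open V'" "V \<subseteq> V'" "AE x in \<mu>. \<iota> x \<in> V' \<longrightarrow> 1 \<le> v x"
    and cv: "ennreal ((?N v)\<^sup>2) + emeasure \<mu> (\<iota> -` V - \<Omega>) < ennreal (2 * e)"
    by (rule Cap_lessE[OF le_less_trans[OF V(2) less]])
  have "Cap \<mu> \<Omega> \<Phi> \<iota> (U \<union> V) \<le> ennreal ((?N (\<lambda>x. max (u x) (v x)))\<^sup>2) + emeasure \<mu> (\<iota> -` (U \<union> V) - \<Omega>)"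
  proof (rule Cap_le[where U = "U' \<union> V'"])
    show "AE x in \<mu>. \<iota> x \<in> U' \<union> V' \<longrightarrow> 1 \<le> max (u x) (v x)"
      using u(4) v(4) by eventually_elim auto
  qed (use u v in \<open>auto intro: W2_max\<close>)
  also have "\<dots> \<le> ennreal (16 * ((?N u)\<^sup>2 + (?N v)\<^sup>2)) +
      (emeasure \<mu> (\<iota> -` U - \<Omega>) + emeasure \<mu> (\<iota> -` V - \<Omega>))"
  proof (intro add_mono ennreal_leI W2_norm_max_le u(1) v(1))
    have "\<iota> -` (U \<union> V) - \<Omega> = (\<iota> -` U - \<Omega>) \<union> (\<iota> -` V - \<Omega>)" by auto
    then show "emeasure \<mu> (\<iota> -` (U \<union> V) - \<Omega>) \<le> emeasure \<mu> (\<iota> -` U - \<Omega>) + emeasure \<mu> (\<iota> -` V - \<Omega>)"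
      using emeasure_subadditive[OF vimage_sets[OF U(1)] vimage_sets[OF V(1)]] by simp
  qed
  \<comment> \<open>The measure terms are enlarged by the same factor 16, which can then be taken
    out of the whole sum.\<close>
  also have "\<dots> \<le> ennreal (16 * ((?N u)\<^sup>2 + (?N v)\<^sup>2)) +
      16 * (emeasure \<mu> (\<iota> -` U - \<Omega>) + emeasure \<mu> (\<iota> -` V - \<Omega>))"
    using mult_right_mono[of 1 "16 :: ennreal" "emeasure \<mu> (\<iota> -` U - \<Omega>) + emeasure \<mu> (\<iota> -` V - \<Omega>)"]
    by (intro add_left_mono) simp
  also have "\<dots> = 16 * ((ennreal ((?N u)\<^sup>2) + emeasure \<mu> (\<iota> -` U - \<Omega>)) +
      (ennreal ((?N v)\<^sup>2) + emeasure \<mu> (\<iota> -` V - \<Omega>)))"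
    by (simp add: ennreal_mult algebra_simps)
  also have "\<dots> \<le> 16 * (ennreal (2 * e) + ennreal (2 * e))"
    using cu cv by (intro mult_left_mono add_mono) auto
  also have "\<dots> = ennreal (64 * e)"
  proof -
    have "ennreal (2 * e) + ennreal (2 * e) = ennreal (4 * e)"
      using e by (subst ennreal_plus[symmetric]) auto
    then show ?thesis using e by (simp add: ennreal_mult'' ennreal_mult')
  qed
  finally show ?thesis .
qed

lemma quasi_continuousE:
  assumes "quasi_continuous \<mu> \<Omega> \<Phi> \<iota> w" "0 < e"
  obtains U where "open U" "Cap \<mu> \<Omega> \<Phi> \<iota> U \<le> ennreal e" "continuous_on (- U) w"
  using assms unfolding quasi_continuous_def by blast

lemma quasi_continuous_lincomb:
  assumes w: "quasi_continuous \<mu> \<Omega> \<Phi> \<iota> w" and z: "quasi_continuous \<mu> \<Omega> \<Phi> \<iota> z"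
  shows "quasi_continuous \<mu> \<Omega> \<Phi> \<iota> (\<lambda>x. w x + c * z x)"
  unfolding quasi_continuous_def
proof (intro allI impI)
  fix e :: real assume "0 < e"
  \<comment> \<open>\<open>Cap_Un_le\<close> loses the factor 64 when the two exceptional sets are
    united.\<close>
  then have e: "0 < e / 64" by simp
  obtain U where U: "open U" "Cap \<mu> \<Omega> \<Phi> \<iota> U \<le> ennreal (e / 64)" "continuous_on (- U) w"
    by (rule quasi_continuousE[OF w e])
  obtain V where V: "open V" "Cap \<mu> \<Omega> \<Phi> \<iota> V \<le> ennreal (e / 64)" "continuous_on (- V) z"
    by (rule quasi_continuousE[OF z e])
  have "continuous_on (- (U \<union> V)) (\<lambda>x. w x + c * z x)"
    by (intro continuous_intros; rule continuous_on_subset[OF U(3)] continuous_on_subset[OF V(3)]; blast)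
  then show "\<exists>U. open U \<and> Cap \<mu> \<Omega> \<Phi> \<iota> U \<le> ennreal e \<and> continuous_on (- U) (\<lambda>x. w x + c * z x)"
    using Cap_Un_le[OF U(1,2) V(1,2) e] U(1) V(1) by (intro exI[of _ "U \<union> V"]) auto
qed

text \<open>Absolute continuity speaks of polar Borel sets. A countable intersection of open sets is
  Borel, and monotonicity of the capacity makes this one polar.\<close>

lemma null_set_of_small_capacity:
  assumes "\<And>n. open (U n)" "\<And>n. Cap \<mu> \<Omega> \<Phi> \<iota> (U n) \<le> ennreal (1 / real (Suc n))"
  shows "(\<Inter>n. U n) \<in> null_sets \<nu>"
proof -
  have "Cap \<mu> \<Omega> \<Phi> \<iota> (\<Inter>n. U n) \<le> 0"
  proof (rule LIMSEQ_le_const)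
    have "(\<lambda>n. ennreal (1 / real (Suc n))) \<longlonglongrightarrow> ennreal 0"
      by (intro tendsto_ennrealI LIMSEQ_Suc[OF lim_1_over_n])
    then show "(\<lambda>n. ennreal (1 / real (Suc n))) \<longlonglongrightarrow> 0" by simp
    show "\<exists>N. \<forall>n\<ge>N. Cap \<mu> \<Omega> \<Phi> \<iota> (\<Inter>n. U n) \<le> ennreal (1 / real (Suc n))"
      using order_trans[OF Cap_mono[of "\<Inter>n. U n" "U n" for n, OF INT_lower[OF UNIV_I] assms(1)] assms(2)]
      by blast
  qed
  moreover have borel: "(\<Inter>n. U n) \<in> sets borel"
    using assms(1) by (intro sets.countable_INT) auto
  ultimately show ?thesis
    using nu_abs_continuous by (auto simp: cap_abs_continuous_def null_sets_def nu_borel)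
qed

text \<open>Off each exceptional open set \<open>w\<close> is continuous, so preimages are Borel
  there. What remains lies in the intersection of the exceptional sets, a null set for
  \<open>\<nu>\<close>, and the completion accepts any subset of it.\<close>

lemma quasi_continuous_measurable:
  assumes w: "quasi_continuous \<mu> \<Omega> \<Phi> \<iota> w"
  shows "w \<in> borel_measurable (completion \<nu>)"
proof -
  have "\<forall>n. \<exists>U. open U \<and> Cap \<mu> \<Omega> \<Phi> \<iota> U \<le> ennreal (1 / real (Suc n)) \<and> continuous_on (- U) w"
    using w unfolding quasi_continuous_def by simp
  then obtain U where U: "\<And>n. open (U n)" "\<And>n. Cap \<mu> \<Omega> \<Phi> \<iota> (U n) \<le> ennreal (1 / real (Suc n))"
    "\<And>n. continuous_on (- U n) w"
    by metis
  have N: "(\<Inter>n. U n) \<in> null_sets \<nu>"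
    by (rule null_set_of_small_capacity[OF U(1,2)])
  show ?thesis
  proof (rule measurableI)
    fix S :: "real set" assume S: "S \<in> sets borel"
    have "w -` S \<inter> - U n \<in> sets \<nu>" for n
    proof -
      have "- U n \<in> sets borel" using U(1)[of n] by simp
      moreover have "w \<in> borel_measurable (restrict_space borel (- U n))"
        by (rule borel_measurable_continuous_on_restrict[OF U(3)])
      ultimately show ?thesis
        using measurable_sets[OF _ S, of w "restrict_space borel (- U n)"]
        by (auto simp: sets_restrict_space_iff space_restrict_space nu_borel)
    qed
    then have "(\<Union>n. w -` S \<inter> - U n) \<in> sets \<nu>" by (intro sets.countable_UN) auto
    moreover have "w -` S = (\<Union>n. w -` S \<inter> - U n) \<union> (w -` S \<inter> (\<Inter>n. U n))" by auto
    ultimately have "w -` S \<in> sets (completion \<nu>)"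
      using N by (intro sets_completionI[where N' = "\<Inter>n. U n"]) auto
    then show "w -` S \<inter> space (completion \<nu>) \<in> sets (completion \<nu>)" by simp
  qed simp
qed

text \<open>If \<open>w\<close> is continuous off the open set \<open>U\<close> and vanishes almost everywhere, then \<open>U\<close> may be
  enlarged by \<open>{w \<noteq> 0}\<close> to an open set of no larger capacity, since only a null set is added.\<close>

lemma quasi_continuous_zero_AE:
  assumes w: "quasi_continuous \<mu> \<Omega> \<Phi> \<iota> w" and zero: "AE x in \<mu>. w (\<iota> x) = 0"
  shows "AE x in completion \<nu>. w x = 0"
proof -
  have "\<exists>V. open V \<and> Cap \<mu> \<Omega> \<Phi> \<iota> V \<le> ennreal (1 / real (Suc n)) \<and> {x. w x \<noteq> 0} \<subseteq> V" for n
  proof -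
    obtain U where U: "open U" "Cap \<mu> \<Omega> \<Phi> \<iota> U \<le> ennreal (1 / real (Suc n))" "continuous_on (- U) w"
      by (rule quasi_continuousE[OF w, of "1 / real (Suc n)"]) simp
    define V where "V = U \<union> {x. w x \<noteq> 0}"
    \<comment> \<open>\<open>- U\<close> is closed and \<open>w\<close> is continuous on it, so the
      zeros of \<open>w\<close> in it form a closed set of the whole space.\<close>
    have "closed (w -` {0} \<inter> - U)"
      using U(1,3) continuous_on_closed_vimage[of "- U" w] by (simp add: closed_Compl)
    moreover have "V = - (w -` {0} \<inter> - U)" by (auto simp: V_def)
    ultimately have V: "open V" by (simp only: open_Compl)
    have ae: "AE x in \<mu>. \<iota> x \<in> V \<longrightarrow> \<iota> x \<in> U"
      using zero by eventually_elim (auto simp: V_def)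
    have "Cap \<mu> \<Omega> \<Phi> \<iota> V \<le> Cap \<mu> \<Omega> \<Phi> \<iota> U"
    proof (rule Cap_greatest)
      fix z U' assume z: "z \<in> W2 \<mu> \<Omega> \<Phi>" "open U'" "U \<subseteq> U'" "AE x in \<mu>. \<iota> x \<in> U' \<longrightarrow> 1 \<le> z x"
      have "Cap \<mu> \<Omega> \<Phi> \<iota> V \<le> ennreal ((W2_norm \<mu> \<Omega> \<Phi> z)\<^sup>2) + emeasure \<mu> (\<iota> -` V - \<Omega>)"
      proof (rule Cap_le[where U = "U' \<union> V"])
        show "AE x in \<mu>. \<iota> x \<in> U' \<union> V \<longrightarrow> 1 \<le> z x"
          using z(4) ae by eventually_elim (use z(3) in auto)
      qed (use z V in auto)
      also have "emeasure \<mu> (\<iota> -` V - \<Omega>) \<le> emeasure \<mu> (\<iota> -` U - \<Omega>)"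
        by (rule emeasure_mono_AE[OF _ vimage_sets[OF U(1)]]) (use ae in \<open>eventually_elim, auto\<close>)
      finally show "Cap \<mu> \<Omega> \<Phi> \<iota> V \<le> ennreal ((W2_norm \<mu> \<Omega> \<Phi> z)\<^sup>2) + emeasure \<mu> (\<iota> -` U - \<Omega>)"
        by (simp add: add_left_mono)
    qed
    with U(2) V show ?thesis by (intro exI[of _ V]) (auto simp: V_def)
  qed
  then obtain V where V: "\<And>n. open (V n)" "\<And>n. Cap \<mu> \<Omega> \<Phi> \<iota> (V n) \<le> ennreal (1 / real (Suc n))"
    "\<And>n. {x. w x \<noteq> 0} \<subseteq> V n"
    by metis
  have "AE x in \<nu>. w x = 0"
    by (rule AE_I'[OF null_set_of_small_capacity[OF V(1,2)]]) (use V(3) in auto)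
  then show ?thesis by (rule AE_completion)
qed

lemma qc_rep_lincomb:
  assumes "qc_rep \<mu> \<Omega> \<Phi> \<iota> u w" "qc_rep \<mu> \<Omega> \<Phi> \<iota> v z"
  shows "qc_rep \<mu> \<Omega> \<Phi> \<iota> (\<lambda>x. u x + c * v x) (\<lambda>x. w x + c * z x)"
proof -
  have "AE x in \<mu>. w (\<iota> x) = u x" "AE x in \<mu>. z (\<iota> x) = v x"
    using assms by (simp_all add: qc_rep_def)
  then have "AE x in \<mu>. w (\<iota> x) + c * z (\<iota> x) = u x + c * v x"
    by eventually_elim simp
  with assms show ?thesis
    by (simp add: qc_rep_def quasi_continuous_lincomb)
qed

text \<open>The difference is a quasi-continuous representative of 0, so
  \<open>quasi_continuous_zero_AE\<close> applies to it.\<close>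

lemma qc_rep_unique:
  assumes w: "qc_rep \<mu> \<Omega> \<Phi> \<iota> u w" and z: "qc_rep \<mu> \<Omega> \<Phi> \<iota> u z"
  shows "AE x in completion \<nu>. w x = z x"
proof -
  have "qc_rep \<mu> \<Omega> \<Phi> \<iota> (\<lambda>x. u x + (-1) * u x) (\<lambda>x. w x + (-1) * z x)"
    by (rule qc_rep_lincomb[OF w z])
  then have "AE x in completion \<nu>. w x + (-1) * z x = 0"
    by (intro quasi_continuous_zero_AE) (simp_all add: qc_rep_def)
  then show ?thesis by eventually_elim simp
qed

text \<open>The choice in \<open>qc\<close> is meaningful only where some representative exists,
  hence the witness \<open>w\<close>.\<close>

lemma qc_rep_qc: "qc_rep \<mu> \<Omega> \<Phi> \<iota> u w \<Longrightarrow> qc_rep \<mu> \<Omega> \<Phi> \<iota> u (qc \<mu> \<Omega> \<Phi> \<iota> u)"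
  unfolding qc_def by (rule someI[of "qc_rep \<mu> \<Omega> \<Phi> \<iota> u"])

lemma qc_rep_measurable: "qc_rep \<mu> \<Omega> \<Phi> \<iota> u w \<Longrightarrow> w \<in> borel_measurable (completion \<nu>)"
  by (simp add: qc_rep_def quasi_continuous_measurable)

lemma qc_AE: "qc_rep \<mu> \<Omega> \<Phi> \<iota> u w \<Longrightarrow> AE x in completion \<nu>. qc \<mu> \<Omega> \<Phi> \<iota> u x = w x"
  by (rule qc_rep_unique[OF qc_rep_qc])

section \<open>The space \<open>V\<close> of functions of finite perturbed energy\<close>

lemma LB_finite_modular: "w \<in> LB \<nu> B \<Longrightarrow> w \<in> P.finite_modular"
  by (auto simp: LB_def intro: P.finite_modular_scaled)

lemma finite_modular_LB: "w \<in> P.finite_modular \<Longrightarrow> w \<in> LB \<nu> B"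
  using P.nn_integral_F[of w] by (auto simp: LB_def P.finite_modular_def intro!: exI[of _ 1])

lemma finite_modular_AE:
  assumes "w \<in> P.finite_modular" "z \<in> borel_measurable (completion \<nu>)" "AE x in completion \<nu>. w x = z x"
  shows "z \<in> P.finite_modular"
proof -
  have "integrable (completion \<nu>) (\<lambda>x. P.pot x (z x))"
    by (rule integrable_cong_AE_imp[OF P.finite_modular_integrable[OF assms(1)] P.pot_measurable[OF assms(2)]])
      (use assms(3) in \<open>eventually_elim, simp\<close>)
  with assms(2) show ?thesis by (simp add: P.finite_modular_def)
qed

abbreviation Q :: "('a \<Rightarrow> real) \<Rightarrow> 'b \<Rightarrow> real" where
  "Q \<equiv> qc \<mu> \<Omega> \<Phi> \<iota>"

abbreviation V :: "('a \<Rightarrow> real) set" where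
  "V \<equiv> W2_LB \<mu> \<Omega> \<Phi> \<iota> \<nu> B"

text \<open>Uniqueness up to null sets lets the chosen representative \<open>Q u\<close> replace an
  arbitrary one, and doubling lets scale 1 replace an arbitrary scale.\<close>

lemma V_iff:
  "u \<in> V \<longleftrightarrow> u \<in> W2 \<mu> \<Omega> \<Phi> \<and> qc_rep \<mu> \<Omega> \<Phi> \<iota> u (Q u) \<and> Q u \<in> P.finite_modular"
proof safe
  assume "u \<in> V"
  then obtain w where w: "u \<in> W2 \<mu> \<Omega> \<Phi>" "qc_rep \<mu> \<Omega> \<Phi> \<iota> u w" "w \<in> LB \<nu> B"
    by (auto simp: W2_LB_def)
  then show "u \<in> W2 \<mu> \<Omega> \<Phi>" "qc_rep \<mu> \<Omega> \<Phi> \<iota> u (Q u)"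
    by (auto intro: qc_rep_qc)
  show "Q u \<in> P.finite_modular"
    by (rule finite_modular_AE[OF LB_finite_modular[OF w(3)] qc_rep_measurable[OF qc_rep_qc[OF w(2)]]
        qc_rep_unique[OF w(2) qc_rep_qc[OF w(2)]]])
qed (auto simp: W2_LB_def intro: finite_modular_LB)

lemma V_W2: "u \<in> V \<Longrightarrow> u \<in> W2 \<mu> \<Omega> \<Phi>"
  and V_rep: "u \<in> V \<Longrightarrow> qc_rep \<mu> \<Omega> \<Phi> \<iota> u (Q u)"
  and V_finite_modular: "u \<in> V \<Longrightarrow> Q u \<in> P.finite_modular"
  by (simp_all add: V_iff)

lemma Q_measurable: "u \<in> V \<Longrightarrow> Q u \<in> borel_measurable (completion \<nu>)"
  by (rule qc_rep_measurable[OF V_rep])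

lemma V_incr: "u \<in> V \<Longrightarrow> incr u \<in> E.finite_modular"
  by (simp add: V_W2 W2_incr)

text \<open>\<open>Q\<close> is a choice for each function separately and respects linear operations
  only almost everywhere; integrals involving \<open>Q\<close> are rewritten through this
  fact.\<close>

lemma Q_lincomb:
  assumes "u \<in> V" "v \<in> V"
  shows "AE x in completion \<nu>. Q (\<lambda>x. u x + c * v x) x = Q u x + c * Q v x"
  by (rule qc_AE[OF qc_rep_lincomb[OF V_rep V_rep, OF assms]])

lemma V_lincomb:
  assumes u: "u \<in> V" and v: "v \<in> V"
  shows "(\<lambda>x. u x + c * v x) \<in> V"
  unfolding W2_LB_def
  using W2_lincomb[OF V_W2 V_W2, OF u v] qc_rep_lincomb[OF V_rep V_rep, OF u v]
    finite_modular_LB[OF P.finite_modular_lincomb[OF V_finite_modular V_finite_modular, OF u v]]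
  by blast

lemma V_scale: "v \<in> V \<Longrightarrow> (\<lambda>x. c * v x) \<in> V"
  using V_lincomb[of v v "c - 1"] by (simp add: algebra_simps)

lemma V_diff: "u \<in> V \<Longrightarrow> v \<in> V \<Longrightarrow> (\<lambda>x. u x - v x) \<in> V"
  using V_lincomb[of u v "-1"] by simp

lemma Q_scale:
  assumes "v \<in> V"
  shows "AE x in completion \<nu>. Q (\<lambda>x. c * v x) x = c * Q v x"
  using Q_lincomb[OF assms assms, of "c - 1"] by (simp add: algebra_simps)

section \<open>The perturbed energy and its derivative along \<open>V\<close>\<close>

definition energy_B_real :: "('a \<Rightarrow> real) \<Rightarrow> real" where
  "energy_B_real u = 1/2 * (LINT p|(\<mu> \<Otimes>\<^sub>M \<mu>). E.pot p (incr u p)) + (LINT x|completion \<nu>. P.pot x (Q u x))"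

lemma energy_B_eq:
  assumes u: "u \<in> V"
  shows "energy_B \<mu> \<Omega> \<Phi> \<iota> \<nu> B u = ennreal (energy_B_real u)"
proof -
  have "energy_B \<mu> \<Omega> \<Phi> \<iota> \<nu> B u = energy \<mu> \<Phi> u + (\<integral>\<^sup>+x. B x (Q u x) \<partial>completion \<nu>)"
    unfolding energy_B_def using V_rep[OF u] by (simp only: if_P[OF exI])
  also have "\<dots> = ennreal (1/2 * (LINT p|(\<mu> \<Otimes>\<^sub>M \<mu>). E.pot p (incr u p))) +
      ennreal (LINT x|completion \<nu>. P.pot x (Q u x))"
    by (simp only: energy_eq[OF W2_W0[OF V_W2[OF u]]] P.nn_integral_F[OF V_finite_modular[OF u]])
  also have "\<dots> = ennreal (energy_B_real u)"
    unfolding energy_B_real_def by (rule ennreal_plus[symmetric]) (simp_all add: E.pot_nonneg P.pot_nonneg)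
  finally show ?thesis .
qed

text \<open>Finiteness excludes the conventional value \<open>\<infinity>\<close>, hence supplies a
  representative, and it bounds the \<open>B\<close>-integral.\<close>

lemma energy_B_finite:
  assumes "u \<in> W2 \<mu> \<Omega> \<Phi>" "energy_B \<mu> \<Omega> \<Phi> \<iota> \<nu> B u < \<infinity>"
  shows "u \<in> V"
proof -
  obtain w where "qc_rep \<mu> \<Omega> \<Phi> \<iota> u w" and fin: "(\<integral>\<^sup>+x. B x (Q u x) \<partial>completion \<nu>) < \<infinity>"
    using assms(2) by (auto simp: energy_B_def split: if_splits)
  then have rep: "qc_rep \<mu> \<Omega> \<Phi> \<iota> u (Q u)" by (blast intro: qc_rep_qc)
  then have "Q u \<in> P.finite_modular"
    using fin by (intro P.finite_modularI qc_rep_measurable)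
  with rep assms(1) show ?thesis by (simp add: V_iff)
qed

lemma energy_B_real_nonneg: "0 \<le> energy_B_real u"
  unfolding energy_B_real_def by (intro add_nonneg_nonneg mult_nonneg_nonneg integral_nonneg_AE) (auto simp: E.pot_nonneg P.pot_nonneg)

abbreviation WF :: "('a \<Rightarrow> real) \<Rightarrow> ('a \<Rightarrow> real) \<Rightarrow> real" where
  "WF \<equiv> weak_form \<mu> \<Omega> \<Phi> \<phi> \<iota> \<nu> \<beta>"

text \<open>Fubini; the integrability over the product comes from
  \<open>E.integrable_f_times\<close>.\<close>

lemma weak_form_eq:
  assumes u: "u \<in> V" and v: "v \<in> V"
  shows "WF u v = 1/2 * (LINT p|(\<mu> \<Otimes>\<^sub>M \<mu>). \<phi> (fst p) (snd p) (incr u p) * incr v p) +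
    (LINT x|completion \<nu>. \<beta> x (Q u x) * Q v x)"
  using integral_fst'[OF E.integrable_f_times[OF V_incr V_incr, OF u v]]
  by (simp add: weak_form_def incr_def)

lemma energy_B_real_lincomb:
  assumes u: "u \<in> V" and v: "v \<in> V"
  shows "energy_B_real (\<lambda>x. u x + c * v x) = 1/2 * (LINT p|(\<mu> \<Otimes>\<^sub>M \<mu>). E.pot p (incr u p + c * incr v p)) +
    (LINT x|completion \<nu>. P.pot x (Q u x + c * Q v x))"
proof -
  have [measurable]: "Q (\<lambda>x. u x + c * v x) \<in> borel_measurable (completion \<nu>)"
    "Q u \<in> borel_measurable (completion \<nu>)" "Q v \<in> borel_measurable (completion \<nu>)"
    by (rule Q_measurable, fact u v V_lincomb[OF u v])+
  have "(LINT x|completion \<nu>. P.pot x (Q (\<lambda>x. u x + c * v x) x)) = (LINT x|completion \<nu>. P.pot x (Q u x + c * Q v x))"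
    by (rule integral_cong_AE)
      (use Q_lincomb[OF u v, of c] in \<open>auto intro!: P.pot_measurable elim!: eventually_mono\<close>)
  then show ?thesis by (simp add: energy_B_real_def incr_lincomb)
qed

lemma energy_B_real_subgradient:
  assumes u: "u \<in> V" and v: "v \<in> V"
  shows "energy_B_real u + WF u v \<le> energy_B_real (\<lambda>x. u x + v x)"
  using E.integral_pot_subgradient[OF V_incr V_incr, OF u v]
    P.integral_pot_subgradient[OF V_finite_modular V_finite_modular, OF u v]
  unfolding energy_B_real_lincomb[OF u v, of 1, simplified] weak_form_eq[OF u v] energy_B_real_def[of u] by simp

lemma weak_form_scale:
  assumes u: "u \<in> V" and v: "v \<in> V"
  shows "WF u (\<lambda>x. c * v x) = c * WF u v"
proof -
  have cv: "(\<lambda>x. c * v x) \<in> V" by (rule V_scale[OF v])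
  have "(LINT x|completion \<nu>. \<beta> x (Q u x) * Q (\<lambda>x. c * v x) x) = (LINT x|completion \<nu>. c * (\<beta> x (Q u x) * Q v x))"
    using Q_scale[OF v, of c] u v cv
    by (intro integral_cong_AE borel_measurable_times P.f_comp_measurable borel_measurable_const Q_measurable)
      (auto elim!: eventually_mono)
  moreover have "incr (\<lambda>x. c * v x) = (\<lambda>p. c * incr v p)"
    by (auto simp: incr_def algebra_simps)
  ultimately show ?thesis
    by (simp add: weak_form_eq[OF u v] weak_form_eq[OF u cv] algebra_simps)
qed

lemma weak_form_tendsto:
  assumes u: "u \<in> V" and v: "v \<in> V"
  shows "(\<lambda>n. WF (\<lambda>x. u x + 1 / real (Suc n) * v x) v) \<longlonglongrightarrow> WF u v"
proof -
  have eq: "WF (\<lambda>x. u x + c * v x) v =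
      1/2 * (LINT p|(\<mu> \<Otimes>\<^sub>M \<mu>). \<phi> (fst p) (snd p) (incr u p + c * incr v p) * incr v p) +
      (LINT x|completion \<nu>. \<beta> x (Q u x + c * Q v x) * Q v x)" for c
  proof -
    have [measurable]: "Q (\<lambda>x. u x + c * v x) \<in> borel_measurable (completion \<nu>)"
      "Q u \<in> borel_measurable (completion \<nu>)" "Q v \<in> borel_measurable (completion \<nu>)"
      by (rule Q_measurable, fact u v V_lincomb[OF u v])+
    have "(LINT x|completion \<nu>. \<beta> x (Q (\<lambda>x. u x + c * v x) x) * Q v x) =
        (LINT x|completion \<nu>. \<beta> x (Q u x + c * Q v x) * Q v x)"
      using Q_lincomb[OF u v, of c]
      by (intro integral_cong_AE borel_measurable_times P.f_comp_measurable) (auto elim!: eventually_mono)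
    then show ?thesis
      by (simp add: weak_form_eq[OF V_lincomb[OF u v] v] incr_lincomb)
  qed
  show ?thesis
    unfolding eq weak_form_eq[OF u v]
    by (intro tendsto_intros E.tendsto_integral_f_times P.tendsto_integral_f_times V_incr V_finite_modular u v)
qed

lemma weak_form_of_subgradient:
  assumes u: "u \<in> V" and v: "v \<in> V"
    and le: "\<And>c. energy_B_real u + c * a \<le> energy_B_real (\<lambda>x. u x + c * v x)"
  shows "WF u v = a"
proof -
  have ge: "b \<le> WF u w" if w: "w \<in> V" and le: "\<And>c. 0 < c \<Longrightarrow> energy_B_real u + c * b \<le> energy_B_real (\<lambda>x. u x + c * w x)" for w b
  proof (rule LIMSEQ_le_const[OF weak_form_tendsto[OF u w]], intro exI allI impI)
    fix n :: nat
    define c where "c = 1 / real (Suc n)"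
    have c: "0 < c" by (simp add: c_def)
    define z where "z x = u x + c * w x" for x
    have z: "z \<in> V" unfolding z_def by (rule V_lincomb[OF u w])
    \<comment> \<open>Moving from \<open>z\<close> by \<open>- c * w\<close> returns to
      \<open>u\<close>, so the supporting inequality bounds the energy of \<open>z\<close> from
      above by \<open>energy_B_real u + c * WF z w\<close>, while \<open>le\<close> bounds it from
      below.\<close>
    have "energy_B_real z + WF z (\<lambda>x. - c * w x) \<le> energy_B_real (\<lambda>x. z x + - c * w x)"
      by (rule energy_B_real_subgradient[OF z V_scale[OF w]])
    moreover have "(\<lambda>x. z x + - c * w x) = u" by (simp add: z_def)
    ultimately have "energy_B_real z - c * WF z w \<le> energy_B_real u"
      using weak_form_scale[OF z w, of "- c"] by simp
    with le[OF c] have "c * b \<le> c * WF z w" by (simp add: z_def[abs_def])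
    then have "b \<le> WF z w" using c by simp
    then show "b \<le> WF (\<lambda>x. u x + 1 / real (Suc n) * w x) w"
      by (simp only: z_def[abs_def] c_def)
  qed
  \<comment> \<open>The hypothesis covers \<open>c\<close> of either sign, so the one-sided bound
    also applies to \<open>- v\<close> and yields the opposite inequality.\<close>
  have "- a \<le> WF u (\<lambda>x. - 1 * v x)"
  proof (rule ge[OF V_scale[OF v]])
    show "energy_B_real u + c * - a \<le> energy_B_real (\<lambda>x. u x + c * (- 1 * v x))" for c
      using le[of "- c"] by simp
  qed
  then have "WF u v \<le> a"
    unfolding weak_form_scale[OF u v] by simp
  with ge[OF v le] show ?thesis by simp
qed

subsection \<open>Elliptic extensions and weak solutions\<close>

abbreviation EB :: "('a \<Rightarrow> real) \<Rightarrow> ennreal" where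
  "EB \<equiv> energy_B \<mu> \<Omega> \<Phi> \<iota> \<nu> B"

lemma enn2ereal_energy_B: "u \<in> V \<Longrightarrow> enn2ereal (EB u) = ereal (energy_B_real u)"
  by (simp add: energy_B_eq energy_B_real_nonneg)

lemma elliptic_extension_V: "elliptic_extension \<mu> \<Omega> \<Phi> EB u f u' \<Longrightarrow> u' \<in> V"
  by (auto simp: elliptic_extension_def intro: energy_B_finite)

lemma elliptic_extension_ineq:
  assumes "elliptic_extension \<mu> \<Omega> \<Phi> EB u f u'" "v \<in> W2 \<mu> \<Omega> \<Phi>"
  shows "ereal (LINT x:\<Omega>|\<mu>. f x * v x) \<le> enn2ereal (EB (\<lambda>x. u' x + v x)) - enn2ereal (EB u')"
  using assms by (simp add: elliptic_extension_def)

lemma elliptic_extension_iff: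
  assumes f: "f \<in> L2 \<mu> \<Omega>"
  shows "elliptic_extension \<mu> \<Omega> \<Phi> EB u f u' \<longleftrightarrow>
    u' \<in> V \<and> restricts_to \<mu> \<Omega> u' u \<and> (\<forall>v\<in>V. WF u' v = (LINT x:\<Omega>|\<mu>. f x * v x))"
proof safe
  assume el: "elliptic_extension \<mu> \<Omega> \<Phi> EB u f u'"
  then show u': "u' \<in> V" by (rule elliptic_extension_V)
  show "restricts_to \<mu> \<Omega> u' u"
    using el by (simp add: elliptic_extension_def)
  fix v assume v: "v \<in> V"
  show "WF u' v = (LINT x:\<Omega>|\<mu>. f x * v x)"
  proof (rule weak_form_of_subgradient[OF u' v])
    fix c
    have "ereal (LINT x:\<Omega>|\<mu>. f x * (c * v x)) \<le> enn2ereal (EB (\<lambda>x. u' x + c * v x)) - enn2ereal (EB u')"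
      by (rule elliptic_extension_ineq[OF el V_W2[OF V_scale[OF v]]])
    moreover have "(\<lambda>x. f x * (c * v x)) = (\<lambda>x. c * (f x * v x))" by auto
    ultimately show "energy_B_real u' + c * (LINT x:\<Omega>|\<mu>. f x * v x) \<le> energy_B_real (\<lambda>x. u' x + c * v x)"
      by (simp add: enn2ereal_energy_B u' V_lincomb[OF u' v])
  qed
next
  assume u': "u' \<in> V" and r: "restricts_to \<mu> \<Omega> u' u"
    and weak: "\<forall>v\<in>V. WF u' v = (LINT x:\<Omega>|\<mu>. f x * v x)"
  have "ereal (LINT x:\<Omega>|\<mu>. f x * v x) \<le> enn2ereal (EB (\<lambda>x. u' x + v x)) - enn2ereal (EB u')"
    if v: "v \<in> W2 \<mu> \<Omega> \<Phi>" for v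
  \<comment> \<open>Directions range over all of \<open>W2\<close>. If the energy at
    \<open>u' + v\<close> is finite, \<open>v\<close> is a difference of elements of
    \<open>V\<close> and the weak identity applies; otherwise the right-hand side is
    \<open>\<infinity>\<close>.\<close>
  proof (cases "EB (\<lambda>x. u' x + v x) < \<infinity>")
    case True
    have sum: "(\<lambda>x. u' x + v x) \<in> V"
      using energy_B_finite[OF _ True] W2_lincomb[OF V_W2[OF u'] v, of 1] by simp
    from V_diff[OF this u'] have vV: "v \<in> V" by simp
    with energy_B_real_subgradient[OF u' vV] weak show ?thesis
      by (simp add: enn2ereal_energy_B u' sum)
  next
    case False
    then have "EB (\<lambda>x. u' x + v x) = \<infinity>" by (simp add: less_top[symmetric])
    then show ?thesis by (simp add: enn2ereal_energy_B u')
  qed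
  then show "elliptic_extension \<mu> \<Omega> \<Phi> EB u f u'"
    using u' r V_W2[OF u'] by (simp add: elliptic_extension_def energy_B_eq)
qed

section \<open>Minimality of elliptic extensions\<close>

lemma set_integral_restricts_eq:
  assumes "f \<in> L2 \<mu> \<Omega>" "w \<in> W2 \<mu> \<Omega> \<Phi>" "z \<in> W2 \<mu> \<Omega> \<Phi>"
    and "restricts_to \<mu> \<Omega> w u" "restricts_to \<mu> \<Omega> z u"
  shows "(LINT x:\<Omega>|\<mu>. f x * w x) = (LINT x:\<Omega>|\<mu>. f x * z x)"
  unfolding set_lebesgue_integral_def
proof (rule integral_cong_AE)
  show "(\<lambda>x. indicat_real \<Omega> x *\<^sub>R (f x * w x)) \<in> borel_measurable \<mu>"
    "(\<lambda>x. indicat_real \<Omega> x *\<^sub>R (f x * z x)) \<in> borel_measurable \<mu>"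
    using L2_times_integrable[OF assms(1) W2_L2] assms(2,3)
    by (auto simp: set_integrable_def intro: borel_measurable_integrable)
  show "AE x in \<mu>. indicat_real \<Omega> x *\<^sub>R (f x * w x) = indicat_real \<Omega> x *\<^sub>R (f x * z x)"
    using assms(4,5) unfolding restricts_to_def by eventually_elim (auto simp: indicator_def)
qed

lemma elliptic_extension_minimal:
  assumes f: "f \<in> L2 \<mu> \<Omega>" and el: "elliptic_extension \<mu> \<Omega> \<Phi> EB u f u'"
    and w: "w \<in> W2 \<mu> \<Omega> \<Phi>" "restricts_to \<mu> \<Omega> w u"
  shows "EB u' \<le> EB w"
proof -
  have u': "u' \<in> V" by (rule elliptic_extension_V[OF el])
  \<comment> \<open>This direction vanishes almost everywhere on \<open>\<Omega>\<close>, so the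
    linear term of the subgradient inequality disappears.\<close>
  define v where "v x = w x - u' x" for x
  have v: "v \<in> W2 \<mu> \<Omega> \<Phi>"
    using W2_lincomb[OF w(1) V_W2[OF u'], of "-1"] by (simp add: v_def[abs_def])
  have "(LINT x:\<Omega>|\<mu>. f x * v x) = (LINT x:\<Omega>|\<mu>. f x * w x) - (LINT x:\<Omega>|\<mu>. f x * u' x)"
    using L2_times_integrable[OF f W2_L2] w(1) V_W2[OF u']
    by (simp add: v_def right_diff_distrib)
  also have "\<dots> = 0"
    using set_integral_restricts_eq[OF f w(1) V_W2[OF u'] w(2)] el by (simp add: elliptic_extension_def)
  finally have "(LINT x:\<Omega>|\<mu>. f x * v x) = 0" .
  moreover have "ereal (LINT x:\<Omega>|\<mu>. f x * v x) \<le> enn2ereal (EB (\<lambda>x. u' x + v x)) - enn2ereal (EB u')"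
    by (rule elliptic_extension_ineq[OF el v])
  moreover have "(\<lambda>x. u' x + v x) = w" by (simp add: v_def)
  ultimately have "0 \<le> enn2ereal (EB w) - ereal (energy_B_real u')"
    by (simp add: enn2ereal_energy_B u' zero_ereal_def)
  \<comment> \<open>\<open>EB w\<close> may be infinite, so the subtraction is undone by
    cases.\<close>
  then have "enn2ereal (EB u') \<le> enn2ereal (EB w)"
    unfolding enn2ereal_energy_B[OF u'] by (cases "enn2ereal (EB w)") auto
  then show ?thesis by (simp add: less_eq_ennreal.rep_eq)
qed

text \<open>On the functions with restriction \<open>u\<close> the linear term is constant, so the
  second functional differs from the first by a constant there.\<close>

lemma elliptic_extension_is_arg_min:
  assumes f: "f \<in> L2 \<mu> \<Omega>" and el: "elliptic_extension \<mu> \<Omega> \<Phi> EB u f u'"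
  shows "is_arg_min EB (\<lambda>w. w \<in> W2 \<mu> \<Omega> \<Phi> \<and> restricts_to \<mu> \<Omega> w u) u'"
    and "is_arg_min (\<lambda>w. enn2ereal (EB w) - ereal (LINT x:\<Omega>|\<mu>. f x * w x))
      (\<lambda>w. w \<in> W2 \<mu> \<Omega> \<Phi> \<and> restricts_to \<mu> \<Omega> w u) u'"
proof -
  have u': "u' \<in> W2 \<mu> \<Omega> \<Phi>" "restricts_to \<mu> \<Omega> u' u"
    using el by (auto simp: elliptic_extension_def)
  show "is_arg_min EB (\<lambda>w. w \<in> W2 \<mu> \<Omega> \<Phi> \<and> restricts_to \<mu> \<Omega> w u) u'"
    using u' elliptic_extension_minimal[OF f el] by (auto simp: is_arg_min_def not_less)
  have "enn2ereal (EB u') - ereal (LINT x:\<Omega>|\<mu>. f x * u' x) \<le> enn2ereal (EB w) - ereal (LINT x:\<Omega>|\<mu>. f x * w x)"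
    if w: "w \<in> W2 \<mu> \<Omega> \<Phi>" "restricts_to \<mu> \<Omega> w u" for w
    using elliptic_extension_minimal[OF f el w] set_integral_restricts_eq[OF f w(1) u'(1) w(2) u'(2)]
    by (intro ereal_minus_mono) (auto simp: less_eq_ennreal.rep_eq)
  with u' show "is_arg_min (\<lambda>w. enn2ereal (EB w) - ereal (LINT x:\<Omega>|\<mu>. f x * w x))
      (\<lambda>w. w \<in> W2 \<mu> \<Omega> \<Phi> \<and> restricts_to \<mu> \<Omega> w u) u'"
    by (auto simp: is_arg_min_def not_less)
qed

text \<open>From left to right, \<open>g\<close> and \<open>f0\<close> are both weak values on
  \<open>D\<close>; their difference lies in the associate space and annihilates \<open>D\<close>,
  so it vanishes. From right to left, \<open>f0\<close> itself serves as \<open>g\<close>.\<close>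

lemma extended_weak_solution_iff:
  assumes f: "f \<in> L2 \<mu> \<Omega>" and D: "D \<subseteq> V" and sep: "separates_associate \<mu> D"
  shows "extended_weak_solution \<mu> \<Omega> \<Phi> \<phi> \<iota> \<nu> B \<beta> D u f u' \<longleftrightarrow>
    elliptic_extension \<mu> \<Omega> \<Phi> EB u f u'"
proof -
  define f0 where "f0 x = (if x \<in> \<Omega> then f x else 0)" for x
  have f0_eq: "f0 = (\<lambda>x. indicator \<Omega> x * f x)"
    by (auto simp: f0_def indicator_def)
  have f0_meas: "f0 \<in> borel_measurable \<mu>"
    unfolding f0_eq by (rule L2_measurable[OF f])
  have times: "(\<lambda>x. f0 x * v x) = (\<lambda>x. indicator \<Omega> x *\<^sub>R (f x * v x))" for v
    by (auto simp: f0_def indicator_def)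
  have int: "integrable \<mu> (\<lambda>x. f0 x * v x)" if "v \<in> V" for v
    using L2_times_integrable[OF f W2_L2[OF V_W2[OF that]]] by (simp add: times set_integrable_def)
  have lint: "(LINT x|\<mu>. f0 x * v x) = (LINT x:\<Omega>|\<mu>. f x * v x)" for v
    by (simp add: times set_lebesgue_integral_def)
  have f0_assoc: "f0 \<in> associate \<mu> D"
    using D int f0_meas by (auto simp: associate_def)
  show ?thesis
  proof
    assume ext: "extended_weak_solution \<mu> \<Omega> \<Phi> \<phi> \<iota> \<nu> B \<beta> D u f u'"
    then obtain g where g: "g \<in> associate \<mu> D" "\<And>v. v \<in> D \<Longrightarrow> WF u' v = (LINT x|\<mu>. g x * v x)"
      and gV: "\<And>v. v \<in> V \<Longrightarrow> WF u' v = (LINT x|\<mu>. g x * v x)"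
      by (auto simp: extended_weak_solution_def weak_solution_def)
    have f0: "WF u' v = (LINT x|\<mu>. f0 x * v x)" if "v \<in> D" for v
      using ext that by (simp add: extended_weak_solution_def weak_solution_def f0_def)
    have g_meas: "g \<in> borel_measurable \<mu>" using g(1) by (simp add: associate_def)
    have g_int: "integrable \<mu> (\<lambda>x. g x * v x)" if "v \<in> D" for v
      using g(1) that by (simp add: associate_def)
    have f0_int: "integrable \<mu> (\<lambda>x. f0 x * v x)" if "v \<in> D" for v
      using int D that by blast
    have "(\<lambda>x. g x - f0 x) \<in> associate \<mu> D"
      using f0_meas g_meas g_int f0_int by (simp add: associate_def left_diff_distrib)
    moreover have "(LINT x|\<mu>. (g x - f0 x) * v x) = 0" if "v \<in> D" for v
      using f0[OF that] g(2)[OF that] by (simp add: left_diff_distrib g_int[OF that] f0_int[OF that])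
    ultimately have ae: "AE x in \<mu>. g x - f0 x = 0"
      using bspec[OF sep[unfolded separates_associate_def], of "\<lambda>x. g x - f0 x"] by simp
    have "WF u' v = (LINT x:\<Omega>|\<mu>. f x * v x)" if v: "v \<in> V" for v
    proof -
      \<comment> \<open>Integrability of \<open>g x * v x\<close> is known so far for
        \<open>v\<close> in \<open>D\<close>; for general \<open>v\<close> in \<open>V\<close>,
        measurability and equality almost everywhere identify the integrals.\<close>
      have "(LINT x|\<mu>. g x * v x) = (LINT x|\<mu>. f0 x * v x)"
        by (intro integral_cong_AE borel_measurable_times g_meas f0_meas W2_measurable V_W2 v)
          (use ae in \<open>eventually_elim, simp\<close>)
      then show ?thesis by (simp add: gV[OF v] lint)
    qed
    then show "elliptic_extension \<mu> \<Omega> \<Phi> EB u f u'"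
      using ext by (auto simp: elliptic_extension_iff[OF f] extended_weak_solution_def)
  next
    assume "elliptic_extension \<mu> \<Omega> \<Phi> EB u f u'"
    then have u': "u' \<in> V" "restricts_to \<mu> \<Omega> u' u" "\<And>v. v \<in> V \<Longrightarrow> WF u' v = (LINT x|\<mu>. f0 x * v x)"
      by (simp_all add: elliptic_extension_iff[OF f] lint)
    then have "weak_solution \<mu> \<Omega> \<Phi> \<phi> \<iota> \<nu> \<beta> D u' f0"
      using D f0_assoc by (auto simp: weak_solution_def)
    with u' show "extended_weak_solution \<mu> \<Omega> \<Phi> \<phi> \<iota> \<nu> B \<beta> D u f u'"
      unfolding extended_weak_solution_def f0_def[abs_def] by blast
  qed
qed

section \<open>Uniqueness under strict convexity\<close>

lemma thick_zero_propagates: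
  assumes thick: "thick \<mu> \<Omega> S"
    and zero: "AE x in \<mu>. x \<in> \<Omega> \<longrightarrow> d x = (0 :: real)"
    and eq: "AE p in \<mu> \<Otimes>\<^sub>M \<mu>. p \<in> S \<longrightarrow> d (fst p) = d (snd p)"
  shows "AE x in \<mu>. d x = 0"
proof -
  obtain A C :: "nat \<Rightarrow> nat \<Rightarrow> 'a set" and I N where N: "N \<in> null_sets \<mu>"
    and chain: "(\<forall>m n. A m n \<in> sets \<mu> \<and> C m n \<in> sets \<mu>) \<and>
       (\<forall>n. A 0 n \<subseteq> \<Omega>) \<and>
       (\<forall>m. I m = {n. 0 < emeasure \<mu> (A m n)}) \<and>
       (\<forall>m n. A m n \<times> C (Suc m) n \<subseteq> S) \<and>
       (\<forall>m. (\<Union>n. A (Suc m) n) = (\<Union>n\<in>I m. C (Suc m) n)) \<and>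
       UNIV - N = (\<Union>m. \<Union>n\<in>I m. A m n)"
    using thick unfolding thick_def by (elim exE bexE) (rule that)
  then have sets: "\<And>m n. A m n \<in> sets \<mu>" and A0: "\<And>n. A 0 n \<subseteq> \<Omega>"
    and I: "\<And>m. I m = {n. 0 < emeasure \<mu> (A m n)}"
    and AC: "\<And>m n. A m n \<times> C (Suc m) n \<subseteq> S"
    and next_gen: "\<And>m. (\<Union>n. A (Suc m) n) = (\<Union>n\<in>I m. C (Suc m) n)"
    and cover: "UNIV - N = (\<Union>m. \<Union>n\<in>I m. A m n)"
    by simp_all
  \<comment> \<open>Passing to slices allows a single good point \<open>x\<close> to decide about
    almost all \<open>y\<close>.\<close>
  have pair: "AE x in \<mu>. AE y in \<mu>. (x, y) \<in> S \<longrightarrow> d x = d y"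
    using AE_pair[OF eq] by simp
  have "\<forall>n. AE x in \<mu>. x \<in> A m n \<longrightarrow> d x = 0" for m
  proof (induction m)
    case 0
    show ?case
    proof
      fix n show "AE x in \<mu>. x \<in> A 0 n \<longrightarrow> d x = 0"
        using zero by eventually_elim (use A0[of n] in auto)
    qed
  next
    case (Suc m)
    \<comment> \<open>Only indices in \<open>I m\<close> pass their sets on to the next generation,
      hence the premise.\<close>
    have "AE y in \<mu>. n \<in> I m \<longrightarrow> y \<in> C (Suc m) n \<longrightarrow> d y = 0" for n
    proof (cases "n \<in> I m")
      case True
      have ae: "AE x in \<mu>. x \<in> A m n \<longrightarrow> d x = 0 \<and> (AE y in \<mu>. (x, y) \<in> S \<longrightarrow> d x = d y)"
        using Suc[rule_format, of n] pair by eventually_elim auto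
      \<comment> \<open>A set of positive measure is not contained in the exceptional null set. One
        point \<open>x\<close> outside that null set carries the value 0 to almost all of
        \<open>C (Suc m) n\<close>, since
        \<open>A m n \<times> C (Suc m) n \<subseteq> S\<close>.\<close>
      have "\<exists>x\<in>A m n. d x = 0 \<and> (AE y in \<mu>. (x, y) \<in> S \<longrightarrow> d x = d y)"
      proof (rule ccontr)
        assume "\<not> ?thesis"
        with ae have "AE x in \<mu>. x \<notin> A m n" by (auto elim!: eventually_mono)
        then have "emeasure \<mu> (A m n) = 0"
          using AE_iff_null_sets[OF sets[of m n]] by (simp add: null_sets_def)
        with True I show False by simp
      qed
      then obtain x where x: "x \<in> A m n" "d x = 0" "AE y in \<mu>. (x, y) \<in> S \<longrightarrow> d x = d y" by blast
      from x(3) show ?thesis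
        by eventually_elim (use x(1,2) AC[of m n] in auto)
    qed simp
    then have "AE y in \<mu>. \<forall>n. n \<in> I m \<longrightarrow> y \<in> C (Suc m) n \<longrightarrow> d y = 0"
      by (simp add: AE_all_countable)
    then have "AE y in \<mu>. \<forall>n. y \<in> A (Suc m) n \<longrightarrow> d y = 0"
      by eventually_elim (use next_gen[of m] in blast)
    then show ?case unfolding AE_all_countable .
  qed
  then have "AE x in \<mu>. \<forall>m n. x \<in> A m n \<longrightarrow> d x = 0"
    unfolding AE_all_countable by blast
  with AE_not_in[OF N] show ?thesis
    by eventually_elim (use cover in blast)
qed

text \<open>The right-hand sides \<open>f\<close> and \<open>g\<close> may differ, because both
  extensions minimize the same functional \<open>EB\<close> over the functions with restriction
  \<open>u\<close>.\<close>

lemma elliptic_extension_unique: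
  assumes f: "f \<in> L2 \<mu> \<Omega>" and g: "g \<in> L2 \<mu> \<Omega>" and thick: "thick \<mu> \<Omega> (S_set \<Phi>)"
    and strict: "\<forall>(x, y) \<in> S_set \<Phi>. strictly_convex_fun (\<Phi> x y)"
    and u': "elliptic_extension \<mu> \<Omega> \<Phi> EB u f u'" and w': "elliptic_extension \<mu> \<Omega> \<Phi> EB u g w'"
  shows "AE x in \<mu>. u' x = w' x"
proof -
  have uV: "u' \<in> V" and wV: "w' \<in> V"
    using u' w' by (auto intro: elliptic_extension_V)
  have ru: "AE x in \<mu>. x \<in> \<Omega> \<longrightarrow> u' x = u x" and rw: "AE x in \<mu>. x \<in> \<Omega> \<longrightarrow> w' x = u x"
    using u' w' by (auto simp: elliptic_extension_def restricts_to_def)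
  define z where "z x = 1/2 * u' x + 1/2 * w' x" for x
  have zV: "z \<in> V"
    unfolding z_def by (intro V_lincomb V_scale uV wV)
  have rz: "restricts_to \<mu> \<Omega> z u"
    unfolding restricts_to_def using ru rw by eventually_elim (auto simp: z_def)
  have "EB u' \<le> EB z" "EB w' \<le> EB z"
    by (rule elliptic_extension_minimal[OF f u' V_W2[OF zV] rz]
        elliptic_extension_minimal[OF g w' V_W2[OF zV] rz])+
  then have min: "energy_B_real u' \<le> energy_B_real z" "energy_B_real w' \<le> energy_B_real z"
    by (simp_all add: energy_B_eq uV wV zV energy_B_real_nonneg)
  \<comment> \<open>The convexity gap of \<open>\<Phi>\<close> at the midpoint; it is nonnegative,
    and its integral is shown to vanish.\<close>
  let ?e = "\<lambda>p. 1/2 * E.pot p (incr u' p) + 1/2 * E.pot p (incr w' p) - E.pot p (incr z p)"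
  have incr_z: "incr z p = 1/2 * incr u' p + (1 - 1/2) * incr w' p" for p
    by (simp add: incr_def z_def algebra_simps)
  have e_int: "integrable (\<mu> \<Otimes>\<^sub>M \<mu>) ?e"
    by (intro Bochner_Integration.integrable_diff Bochner_Integration.integrable_add integrable_mult_right
        E.finite_modular_integrable V_incr uV wV zV)
  have e_nonneg: "0 \<le> ?e p" for p
    using E.pot_convex[of "1/2" p "incr u' p" "incr w' p"] unfolding incr_z by simp
  have Pz: "(LINT x|completion \<nu>. P.pot x (Q z x)) \<le>
      (LINT x|completion \<nu>. 1/2 * P.pot x (Q u' x) + 1/2 * P.pot x (Q w' x))"
  proof (rule integral_mono_AE)
    show "AE x in completion \<nu>. P.pot x (Q z x) \<le> 1/2 * P.pot x (Q u' x) + 1/2 * P.pot x (Q w' x)"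
      using Q_lincomb[OF V_scale[OF uV, of "1/2"] wV, of "1/2"] Q_scale[OF uV, of "1/2"]
    proof eventually_elim
      case (elim x)
      then have "Q z x = 1/2 * Q u' x + (1 - 1/2) * Q w' x" by (simp add: z_def[abs_def])
      then show ?case using P.pot_convex[of "1/2" x "Q u' x" "Q w' x"] by simp
    qed
  qed (intro Bochner_Integration.integrable_add integrable_mult_right P.finite_modular_integrable
      V_finite_modular uV wV zV)+
  have "(LINT p|(\<mu> \<Otimes>\<^sub>M \<mu>). ?e p) = 1/2 * (LINT p|(\<mu> \<Otimes>\<^sub>M \<mu>). E.pot p (incr u' p)) +
      1/2 * (LINT p|(\<mu> \<Otimes>\<^sub>M \<mu>). E.pot p (incr w' p)) - (LINT p|(\<mu> \<Otimes>\<^sub>M \<mu>). E.pot p (incr z p))"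
    by (simp add: E.finite_modular_integrable V_incr uV wV zV)
  moreover have "(LINT x|completion \<nu>. 1/2 * P.pot x (Q u' x) + 1/2 * P.pot x (Q w' x)) =
      1/2 * (LINT x|completion \<nu>. P.pot x (Q u' x)) + 1/2 * (LINT x|completion \<nu>. P.pot x (Q w' x))"
    by (simp add: P.finite_modular_integrable V_finite_modular uV wV)
  \<comment> \<open>The average of the two minimality inequalities says that half of this integral
    plus the convexity gap of the \<open>B\<close>-term is at most 0, and \<open>Pz\<close> makes
    that second gap nonnegative.\<close>
  ultimately have "(LINT p|(\<mu> \<Otimes>\<^sub>M \<mu>). ?e p) \<le> 0"
    using min Pz unfolding energy_B_real_def by linarith
  then have "(LINT p|(\<mu> \<Otimes>\<^sub>M \<mu>). ?e p) = 0"
    by (intro antisym integral_nonneg_AE AE_I2 e_nonneg)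
  then have "AE p in \<mu> \<Otimes>\<^sub>M \<mu>. ?e p = 0"
    using integral_nonneg_eq_0_iff_AE[OF e_int] e_nonneg by auto
  then have eq: "AE p in \<mu> \<Otimes>\<^sub>M \<mu>. p \<in> S_set \<Phi> \<longrightarrow> u' (fst p) - w' (fst p) = u' (snd p) - w' (snd p)"
  proof eventually_elim
    case (elim p)
    show ?case
    proof (rule impI, rule ccontr)
      assume "p \<in> S_set \<Phi>" and ne: "u' (fst p) - w' (fst p) \<noteq> u' (snd p) - w' (snd p)"
      then have "strictly_convex_fun (\<Phi> (fst p) (snd p))"
        using strict by (auto simp: case_prod_beta)
      moreover have "incr u' p \<noteq> incr w' p" using ne by (simp add: incr_def)
      ultimately have "\<Phi> (fst p) (snd p) (1/2 * incr u' p + (1 - 1/2) * incr w' p) <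
          ennreal (1/2) * \<Phi> (fst p) (snd p) (incr u' p) + ennreal (1 - 1/2) * \<Phi> (fst p) (snd p) (incr w' p)"
        unfolding strictly_convex_fun_def E.F_pot
        by (elim allE[of _ "incr u' p"] allE[of _ "incr w' p"] allE[of _ "1/2"] mp) simp
      also have "\<dots> = ennreal (1/2 * E.pot p (incr u' p) + 1/2 * E.pot p (incr w' p))"
      proof -
        have "ennreal (1/2) * ennreal a = ennreal (1/2 * a)" if "0 \<le> a" for a
          by (rule ennreal_mult[symmetric]) (use that in auto)
        moreover have "1 - 1/2 = (1/2 :: real)" by simp
        ultimately show ?thesis
          by (simp only: E.F_pot E.pot_nonneg) (rule ennreal_plus[symmetric], auto simp: E.pot_nonneg)
      qed
      finally have "E.pot p (incr z p) < 1/2 * E.pot p (incr u' p) + 1/2 * E.pot p (incr w' p)"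
        unfolding E.F_pot incr_z[symmetric] by (simp only: ennreal_less_iff E.pot_nonneg)
      with elim show False by simp
    qed
  qed
  have "AE x in \<mu>. x \<in> \<Omega> \<longrightarrow> u' x - w' x = 0"
    using ru rw by eventually_elim auto
  from thick_zero_propagates[OF thick this eq] show ?thesis
    by eventually_elim simp
qed

end

section \<open>From the hypotheses of the theorem to the two potentials\<close>

lemma delta2_completion:
  assumes "delta2 M F" shows "delta2 (completion M) F"
proof -
  obtain K h where "0 < K" "integrable M h" "\<forall>x. 0 \<le> h x"
    "\<forall>x s. F x (2 * s) \<le> ennreal K * F x s + ennreal (h x)"
    using assms unfolding delta2_def by blast
  moreover from this have "integrable (completion M) h"
    using integrable_completion[of h M] by (auto dest: borel_measurable_integrable)
  ultimately show ?thesis unfolding delta2_def by blast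
qed

lemma potential_of_condition_D:
  assumes "condition_C \<mu> \<Phi>" "delta2 (\<mu> \<Otimes>\<^sub>M \<mu>) (\<lambda>(x, y). \<Phi> x y)" "condition_D \<mu> \<Phi> \<phi>"
  shows "potential (\<mu> \<Otimes>\<^sub>M \<mu>) (\<lambda>p. \<Phi> (fst p) (snd p)) (\<lambda>p. \<phi> (fst p) (snd p))"
  using assms unfolding potential_def condition_C_def condition_D_def case_prod_beta by metis

lemma potential_of_condition_DB:
  assumes "\<And>s. (\<lambda>x. B x s) \<in> borel_measurable \<nu>" "delta2 \<nu> B" "condition_DB \<nu> B \<beta>"
  shows "potential (completion \<nu>) B \<beta>"
  using assms delta2_completion[OF assms(2)] unfolding potential_def condition_DB_def
  by (metis measurable_completion)

theorem theorem6p4: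
  fixes \<mu> :: "'a::t2_space measure"
    and \<Omega> :: "'a set"
    and \<Phi> :: "'a \<Rightarrow> 'a \<Rightarrow> real \<Rightarrow> ennreal"
    and \<phi> :: "'a \<Rightarrow> 'a \<Rightarrow> real \<Rightarrow> real"
    and \<iota> :: "'a \<Rightarrow> 'b::topological_space"
    and \<nu> :: "'b measure"
    and B :: "'b \<Rightarrow> real \<Rightarrow> ennreal"
    and \<beta> :: "'b \<Rightarrow> real \<Rightarrow> real"
    and D :: "('a \<Rightarrow> real) set"
  assumes mu_borel: "sets \<mu> = sets borel"
    and mu_sigma_finite: "sigma_finite_measure \<mu>"
    and mu_full_support: "\<And>U. open U \<Longrightarrow> U \<noteq> {} \<Longrightarrow> 0 < emeasure \<mu> U"
    and Omega_borel: "\<Omega> \<in> sets borel"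
    and standard: "standard_conditions \<mu> \<Omega> \<Phi>"
    and compactification: "compactification \<iota>"
    and regular: "regular_energy \<mu> \<Omega> \<Phi> \<iota>"
    and B_zero: "\<And>x. B x 0 = 0"
    and B_lsc: "\<And>x. lsc_fun (B x)"
    and B_convex: "\<And>x. convex_fun (B x)"
    and B_measurable: "\<And>s. (\<lambda>x. B x s) \<in> borel_measurable borel"
    and nu_borel: "sets \<nu> = sets borel"
    and nu_abs_continuous: "cap_abs_continuous \<mu> \<Omega> \<Phi> \<iota> \<nu>"
    and B_delta2: "delta2 \<nu> B"
    and B_conjugate_delta2: "delta2 \<nu> (\<lambda>x. conjugate (B x))"
    and Phi_D: "condition_D \<mu> \<Phi> \<phi>"
    and B_D: "condition_DB \<nu> B \<beta>"
    and D_subspace: "linear_subspace D"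
    and D_subset: "D \<subseteq> W2_LB \<mu> \<Omega> \<Phi> \<iota> \<nu> B"
    and D_separates: "separates_associate \<mu> D"
  shows "(\<forall>u \<in> L2 \<mu> \<Omega>. \<forall>f \<in> L2 \<mu> \<Omega>.
            ((u, f) \<in> j_subgradient \<mu> \<Omega> \<Phi> (energy_B \<mu> \<Omega> \<Phi> \<iota> \<nu> B) \<longleftrightarrow>
               (\<exists>u'. extended_weak_solution \<mu> \<Omega> \<Phi> \<phi> \<iota> \<nu> B \<beta> D u f u')) \<and>
            (\<forall>u'. extended_weak_solution \<mu> \<Omega> \<Phi> \<phi> \<iota> \<nu> B \<beta> D u f u' \<longrightarrow>
               elliptic_extension \<mu> \<Omega> \<Phi> (energy_B \<mu> \<Omega> \<Phi> \<iota> \<nu> B) u f u' \<and>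
               is_arg_min
                 (\<lambda>w. enn2ereal (energy_B \<mu> \<Omega> \<Phi> \<iota> \<nu> B w) - ereal (LINT x:\<Omega>|\<mu>. f x * w x))
                 (\<lambda>w. w \<in> W2 \<mu> \<Omega> \<Phi> \<and> restricts_to \<mu> \<Omega> w u) u' \<and>
               is_arg_min (energy_B \<mu> \<Omega> \<Phi> \<iota> \<nu> B)
                 (\<lambda>w. w \<in> W2 \<mu> \<Omega> \<Phi> \<and> restricts_to \<mu> \<Omega> w u) u')) \<and>
         ((\<forall>(x, y) \<in> S_set \<Phi>. strictly_convex_fun (\<Phi> x y)) \<longrightarrow>
            (\<forall>u \<in> L2 \<mu> \<Omega>. \<forall>f \<in> L2 \<mu> \<Omega>. \<forall>g \<in> L2 \<mu> \<Omega>. \<forall>u' w'.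
               elliptic_extension \<mu> \<Omega> \<Phi> (energy_B \<mu> \<Omega> \<Phi> \<iota> \<nu> B) u f u' \<longrightarrow>
               elliptic_extension \<mu> \<Omega> \<Phi> (energy_B \<mu> \<Omega> \<Phi> \<iota> \<nu> B) u g w' \<longrightarrow>
               (AE x in \<mu>. u' x = w' x)))"
proof -
  from standard have C: "condition_C \<mu> \<Phi>" and delta2: "delta2 (\<mu> \<Otimes>\<^sub>M \<mu>) (\<lambda>(x, y). \<Phi> x y)"
    and thick: "thick \<mu> \<Omega> (S_set \<Phi>)"
    by (simp_all add: standard_conditions_def)
  have B_meas: "(\<lambda>x. B x s) \<in> borel_measurable \<nu>" for s
    using B_measurable[of s] by (simp cong: measurable_cong_sets[OF nu_borel refl])
  interpret perturbed_energy \<mu> \<Omega> \<Phi> \<phi> \<iota> \<nu> B \<beta>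
    using compactification
    by (intro perturbed_energy.intro mu_borel mu_sigma_finite Omega_borel nu_borel nu_abs_continuous
        potential_of_condition_D[OF C delta2 Phi_D] potential_of_condition_DB[OF B_meas B_delta2 B_D])
      (simp add: compactification_def)
  note ext_iff = extended_weak_solution_iff[OF _ D_subset D_separates]
  show ?thesis
  proof (intro conjI ballI allI impI)
    fix u f assume "u \<in> L2 \<mu> \<Omega>" and f: "f \<in> L2 \<mu> \<Omega>"
    then show "(u, f) \<in> j_subgradient \<mu> \<Omega> \<Phi> (energy_B \<mu> \<Omega> \<Phi> \<iota> \<nu> B) \<longleftrightarrow>
        (\<exists>u'. extended_weak_solution \<mu> \<Omega> \<Phi> \<phi> \<iota> \<nu> B \<beta> D u f u')"
      by (simp add: j_subgradient_def ext_iff)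
    fix u' assume "extended_weak_solution \<mu> \<Omega> \<Phi> \<phi> \<iota> \<nu> B \<beta> D u f u'"
    then show el: "elliptic_extension \<mu> \<Omega> \<Phi> (energy_B \<mu> \<Omega> \<Phi> \<iota> \<nu> B) u f u'"
      by (simp add: ext_iff[OF f])
    show "is_arg_min
        (\<lambda>w. enn2ereal (energy_B \<mu> \<Omega> \<Phi> \<iota> \<nu> B w) - ereal (LINT x:\<Omega>|\<mu>. f x * w x))
        (\<lambda>w. w \<in> W2 \<mu> \<Omega> \<Phi> \<and> restricts_to \<mu> \<Omega> w u) u'"
      "is_arg_min (energy_B \<mu> \<Omega> \<Phi> \<iota> \<nu> B) (\<lambda>w. w \<in> W2 \<mu> \<Omega> \<Phi> \<and> restricts_to \<mu> \<Omega> w u) u'"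
      by (rule elliptic_extension_is_arg_min[OF f el])+
  next
    fix u f g u' w'
    assume "\<forall>(x, y) \<in> S_set \<Phi>. strictly_convex_fun (\<Phi> x y)" "f \<in> L2 \<mu> \<Omega>" "g \<in> L2 \<mu> \<Omega>"
      "elliptic_extension \<mu> \<Omega> \<Phi> (energy_B \<mu> \<Omega> \<Phi> \<iota> \<nu> B) u f u'"
      "elliptic_extension \<mu> \<Omega> \<Phi> (energy_B \<mu> \<Omega> \<Phi> \<iota> \<nu> B) u g w'"
    then show "AE x in \<mu>. u' x = w' x"
      using elliptic_extension_unique[OF _ _ thick] by blast
  qed
qed

end
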